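(* For $j\in\{1,2\}$ let $x_j=e^{z_j}$ and $u_j=e^{v_j}$. Then $$\mathrm{Coeff}_{y^0}\left(\frac{(x_1x_2y)_\infty(y)_\infty}{(x_1y)_\infty(x_2y)_\infty}\cdot\frac{(u_1u_2y^{-1}q)_\infty(y^{-1}q)_\infty}{(u_1y^{-1}q)_\infty(u_2y^{-1}q)_\infty}\right)\in{\rm q}\mathcal{BD}[[z_1,z_2,v_1,v_2]].$$ More precisely, for all $m,n,\tilde m,\tilde n\ge0$, the coefficient of $z_1^mz_2^nv_1^{\tilde m}v_2^{\tilde n}$ in this expression is a finite $\mathbb{Q}$-linear combination of bi-brackets in ${\rm q}\mathcal{BD}$ of weights at most $m+n+\tilde m+\tilde n$.
   Context: $q,y$ are formal variables, $(a)_\infty=(a;q)_\infty=\prod_{n\ge0}(1-aq^n)$, and the product above is expanded as an element of $\mathbb{Q}[[q,y,y^{-1},z_1,z_2,v_1,v_2]]$; $\mathrm{Coeff}_{y^0}$ denotes the coefficient of $y^0$. For integers $\ell\ge0$, $s_1,\dots,s_\ell\ge1$, $r_1,\dots,r_\ell\ge0$, the bi-bracket is $$\begin{bmatrix} s_1,\dots,s_\ell\\ r_1,\dots,r_\ell\end{bmatrix}=\sum_{\substack{u_1>\cdots>u_\ell>0\\ v_1,\dots,v_\ell>0}}\frac{u_1^{r_1}\cdots u_\ell^{r_\ell}}{r_1!\cdots r_\ell!}\cdot\frac{v_1^{s_1-1}\cdots v_\ell^{s_\ell-1}}{(s_1-1)!\cdots(s_\ell-1)!}\,q^{u_1v_1+\cdots+u_\ell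 v_\ell}\in\mathbb{Q}[[q]],$$ of weight $\sum_{i=1}^\ell(s_i+r_i)$ (the empty bi-bracket equals $1$). ${\rm q}\mathcal{BD}$ is the $\mathbb{Q}$-span of all bi-brackets with $\ell=0$ or $s_1>1$. *)

theory Defs
  imports "HOL-Analysis.Analysis" "HOL-Computational_Algebra.Formal_Laurent_Series"
begin

unbundle no vec_syntax
unbundle fps_syntax

subsection \<open>Bi-brackets\<close>

text \<open>
  The bi-bracket with upper row \<open>ss\<close> and lower row \<open>rs\<close>, as a formal power series in \<open>q\<close>: its
  coefficient at \<open>q^N\<close> collects the (finitely many, see below) pairs \<open>(us, vs)\<close> with
  \<open>u\<^sub>1 v\<^sub>1 + \<dots> + u\<^sub>l v\<^sub>l = N\<close>.
\<close>

definition bi_bracket_index :: "nat \<Rightarrow> nat \<Rightarrow> (nat list \<times> nat list) set" where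
  "bi_bracket_index l N =
     {(us, vs). length us = l \<and> length vs = l \<and> sorted_wrt (>) us \<and>
        (\<forall>u\<in>set us. u > 0) \<and> (\<forall>v\<in>set vs. v > 0) \<and> (\<Sum>i<l. us ! i * vs ! i) = N}"

definition bi_bracket :: "nat list \<Rightarrow> nat list \<Rightarrow> rat fps" where
  "bi_bracket ss rs = Abs_fps (\<lambda>N. \<Sum>(us, vs)\<in>bi_bracket_index (length ss) N.
     \<Prod>i<length ss. of_nat (us ! i) ^ (rs ! i) / fact (rs ! i) *
       (of_nat (vs ! i) ^ (ss ! i - 1) / fact (ss ! i - 1)))"

definition bi_weight :: "nat list \<Rightarrow> nat list \<Rightarrow> nat" where
  "bi_weight ss rs = sum_list ss + sum_list rs"

definition bi_admissible :: "nat list \<Rightarrow> nat list \<Rightarrow> bool" where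
  "bi_admissible ss rs \<longleftrightarrow>
     length ss = length rs \<and> (\<forall>s\<in>set ss. s \<ge> 1) \<and> (ss = [] \<or> hd ss > 1)"

definition rat_span :: "rat fps set \<Rightarrow> rat fps set" where
  "rat_span = module.span (\<lambda>c f. fps_const c * f)"

definition qBD :: "rat fps set" where
  "qBD = rat_span {bi_bracket ss rs | ss rs. bi_admissible ss rs}"

definition qBD_upto :: "nat \<Rightarrow> rat fps set" where
  "qBD_upto k = rat_span {bi_bracket ss rs | ss rs. bi_admissible ss rs \<and> bi_weight ss rs \<le> k}"

lemma finite_bi_bracket_index: "finite (bi_bracket_index l N)"
proof (rule finite_subset)
  let ?L = "{xs. set xs \<subseteq> {..N} \<and> length xs = l}"
  show "finite (?L \<times> ?L)"
    by (intro finite_cartesian_product finite_lists_length_eq) auto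
  show "bi_bracket_index l N \<subseteq> ?L \<times> ?L"
  proof
    fix p assume "p \<in> bi_bracket_index l N"
    then obtain us vs where p: "p = (us, vs)" "length us = l" "length vs = l"
      "\<And>i. i < l \<Longrightarrow> us ! i > 0" "\<And>i. i < l \<Longrightarrow> vs ! i > 0" "(\<Sum>i<l. us ! i * vs ! i) = N"
      by (auto simp: bi_bracket_index_def)
    have le: "us ! i * vs ! i \<le> N" if "i < l" for i
      using member_le_sum[of i "{..<l}" "\<lambda>i. us ! i * vs ! i"] that p(6) by auto
    have "us ! i \<le> N" "vs ! i \<le> N" if "i < l" for i
    proof -
      have "us ! i \<le> us ! i * vs ! i" "vs ! i \<le> us ! i * vs ! i"
        using p(4,5)[OF that] by simp_all
      with le[OF that] show "us ! i \<le> N" "vs ! i \<le> N" by linarith+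
    qed
    then show "p \<in> ?L \<times> ?L"
      using p(1-3) by (auto simp: in_set_conv_nth)
  qed
qed

lemma vector_space_rat_fps: "vector_space (\<lambda>(c::rat) (f::rat fps). fps_const c * f)"
proof
  fix a b :: rat and x y :: "rat fps"
  show "fps_const a * (x + y) = fps_const a * x + fps_const a * y"
    by (rule distrib_left)
  show "fps_const (a + b) * x = fps_const a * x + fps_const b * x"
    by (simp only: fps_const_add [symmetric] distrib_right)
  show "fps_const a * (fps_const b * x) = fps_const (a * b) * x"
    by (simp only: fps_const_mult [symmetric] mult.assoc)
  show "fps_const 1 * x = x" by simp
qed


subsection \<open>The generating series\<close>

text \<open>
  \<open>\<rat>[[z\<^sub>1, z\<^sub>2, v\<^sub>1, v\<^sub>2]]\<close> is represented by iterated power series with \<open>z\<^sub>1\<close> the outermost and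
  \<open>v\<^sub>2\<close> the innermost variable: \<open>f $ m $ n $ m' $ n'\<close> is the coefficient of
  \<open>z\<^sub>1^m z\<^sub>2^n v\<^sub>1^m' v\<^sub>2^n'\<close>.
\<close>

type_synonym 'a fps4 = "'a fps fps fps fps"

definition exp_z1 :: "rat fps4" where
  "exp_z1 = Abs_fps (\<lambda>n. fps_const (fps_const (fps_const (fps_exp 1 $ n))))"

definition exp_z2 :: "rat fps4" where
  "exp_z2 = fps_const (Abs_fps (\<lambda>n. fps_const (fps_const (fps_exp 1 $ n))))"

definition exp_v1 :: "rat fps4" where
  "exp_v1 = fps_const (fps_const (Abs_fps (\<lambda>n. fps_const (fps_exp 1 $ n))))"

definition exp_v2 :: "rat fps4" where
  "exp_v2 = fps_const (fps_const (fps_const (fps_exp 1)))"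

text \<open>
  The product is expanded in \<open>\<rat>[[z\<^sub>1, z\<^sub>2, v\<^sub>1, v\<^sub>2]]((y))[[q]]\<close>, power series in \<open>q\<close> whose coefficients
  are Laurent series in \<open>y\<close>.  Here \<open>1 / (1 - x y)\<close> is the geometric series in \<open>y\<close>, and
  \<open>1 / (1 - x y q^n)\<close> and \<open>1 / (1 - u y\<inverse> q^n)\<close> for \<open>n \<ge> 1\<close> are geometric series in \<open>y q^n\<close> and
  \<open>y\<inverse> q^n\<close>.
\<close>

type_synonym qy_series = "rat fps4 fls fps"

definition embed_coeff :: "rat fps4 \<Rightarrow> qy_series" where
  "embed_coeff c = fps_const (fls_const c)"

definition Y :: qy_series where "Y = fps_const fls_X"

definition Y_inv :: qy_series where "Y_inv = fps_const fls_X_inv"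

text \<open>The infinite product is taken in the \<open>q\<close>-adic topology.\<close>

definition qpoch_inf :: "'a::idom fps \<Rightarrow> 'a fps" where
  "qpoch_inf a = (\<Prod>n. 1 - a * fps_X ^ n)"

definition gen_series :: qy_series where
  "gen_series =
     (let x1 = embed_coeff exp_z1; x2 = embed_coeff exp_z2; u1 = embed_coeff exp_v1; u2 = embed_coeff exp_v2; q = fps_X in
       qpoch_inf (x1 * x2 * Y) * qpoch_inf Y *
       inverse (qpoch_inf (x1 * Y)) * inverse (qpoch_inf (x2 * Y)) *
       (qpoch_inf (u1 * u2 * Y_inv * q) * qpoch_inf (Y_inv * q) *
        inverse (qpoch_inf (u1 * Y_inv * q)) * inverse (qpoch_inf (u2 * Y_inv * q))))"

text \<open>The coefficient of \<open>y^0\<close>, regrouped as an element of \<open>\<rat>[[q]][[z\<^sub>1, z\<^sub>2, v\<^sub>1, v\<^sub>2]]\<close>.\<close>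

definition coeff_y0 :: "qy_series \<Rightarrow> rat fps fps4" where
  "coeff_y0 F = Abs_fps (\<lambda>m. Abs_fps (\<lambda>n. Abs_fps (\<lambda>m'. Abs_fps (\<lambda>n'.
     Abs_fps (\<lambda>k. (F $ k) $$ 0 $ m $ n $ m' $ n')))))"

definition fps4_over :: "'a set \<Rightarrow> 'a fps4 set" where
  "fps4_over S = {F. \<forall>m n m' n'. F $ m $ n $ m' $ n' \<in> S}"


subsection \<open>Well-definedness of the products and quotients\<close>

lemma qpoch_inf_aux:
  fixes a :: "'a::idom fps"
  assumes "a $ 0 \<noteq> 1"
  obtains L where "(\<lambda>n. 1 - a * fps_X ^ n) has_prod L" "L $ 0 = 1 - a $ 0"
proof -
  define p where "p = (\<lambda>n. \<Prod>i\<le>n. 1 - a * fps_X ^ i)"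
  define L where "L = Abs_fps (\<lambda>k. p k $ k)"
  have step: "p (Suc n) $ k = p n $ k" if "k \<le> n" for n k
  proof -
    have "p (Suc n) = p n - (p n * a) * fps_X ^ Suc n"
      by (simp add: p_def algebra_simps)
    then show ?thesis using that by (simp add: fps_X_power_mult_right_nth del: power_Suc)
  qed
  have const: "p n $ k = p k $ k" if "k \<le> n" for n k
    using that by (induction rule: dec_induct) (auto simp: step)
  have lim: "p \<longlonglongrightarrow> L"
  proof (rule tendsto_fpsI)
    fix k show "\<forall>\<^sub>F n in sequentially. p n $ k = L $ k"
      unfolding L_def fps_nth_Abs_fps
      using eventually_ge_at_top[of k] by eventually_elim (rule const)
  qed
  have L0: "L $ 0 = 1 - a $ 0" by (simp add: L_def p_def)
  then have "L \<noteq> 0" using assms by auto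
  with lim have "(\<lambda>n. 1 - a * fps_X ^ n) has_prod L"
    by (simp add: has_prod_def raw_has_prod_def p_def)
  with L0 show thesis using that by blast
qed

lemma has_prod_qpoch_inf:
  fixes a :: "'a::idom fps"
  assumes "a $ 0 \<noteq> 1"
  shows "(\<lambda>n. 1 - a * fps_X ^ n) has_prod qpoch_inf a"
  unfolding qpoch_inf_def by (rule qpoch_inf_aux[OF assms]) (metis has_prod_unique)

lemma qpoch_inf_nth_0:
  fixes a :: "'a::idom fps"
  assumes "a $ 0 \<noteq> 1"
  shows "qpoch_inf a $ 0 = 1 - a $ 0"
  unfolding qpoch_inf_def by (rule qpoch_inf_aux[OF assms]) (metis has_prod_unique)

lemma inverse_one_fps4: "inverse (1 :: rat fps4) = 1"
  by (intro fps_inverse_one') simp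

lemma fls_one_minus_X_inverse:
  fixes c :: "rat fps4"
  shows "(1 - fls_const c * fls_X) * inverse (1 - fls_const c * fls_X) = 1"
proof -
  let ?f = "1 - fls_const c * fls_X"
  have "fls_subdegree ?f = 0"
    by (rule fls_subdegree_eqI) (auto simp: fls_X_times_conv_shift)
  moreover have "?f $$ 0 = 1" by (simp add: fls_X_times_conv_shift)
  ultimately show ?thesis
    using fls_right_inverse[of ?f 1] by (simp add: fls_inverse_def' inverse_one_fps4)
qed

lemma fps_mult_inverse_eq_1:
  fixes f :: "'a::{comm_ring_1,inverse} fps"
  assumes "f $ 0 * inverse (f $ 0) = 1"
  shows "f * inverse f = 1"
  using fps_right_inverse[OF assms] by (simp add: fps_inverse_def)

lemma Y_times_neq_1: "(embed_coeff c * Y) $ 0 \<noteq> 1"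
proof
  assume "(embed_coeff c * Y) $ 0 = 1"
  then have "(embed_coeff c * Y) $ 0 $$ 0 = 1 $$ 0" by simp
  then show False by (simp add: embed_coeff_def Y_def fls_X_times_conv_shift)
qed

lemma qpoch_inf_Y_inverse:
  "qpoch_inf (embed_coeff c * Y) * inverse (qpoch_inf (embed_coeff c * Y)) = 1"
  by (rule fps_mult_inverse_eq_1, subst (1 2) qpoch_inf_nth_0[OF Y_times_neq_1])
    (simp add: embed_coeff_def Y_def fls_one_minus_X_inverse)

lemma qpoch_inf_Y_inv_inverse:
  "qpoch_inf (embed_coeff c * Y_inv * fps_X) *
   inverse (qpoch_inf (embed_coeff c * Y_inv * fps_X)) = 1"
proof -
  have "inverse (1 :: rat fps4 fls) = 1"
    using fls_one_minus_X_inverse[of 0] by simp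
  then show ?thesis
    by (intro fps_mult_inverse_eq_1) (simp add: qpoch_inf_nth_0)
qed

end

theory Submission
  imports Defs
begin

text \<open>
  Write the first quotient as \<open>\<Sum>\<^sub>N a\<^sub>N y^N\<close> and the second one, with \<open>q / y\<close> for \<open>y\<close>, in the same
  way with coefficients \<open>b\<^sub>N\<close>; the wanted coefficient is \<open>\<Sum>\<^sub>N q^N a\<^sub>N b\<^sub>N\<close>.  Comparing with \<open>y \<mapsto> q y\<close>
  gives \<open>q^N a\<^sub>N = q^N / (1 - q^N) \<Sum>\<^sub>n \<alpha>\<^sub>n q^(N-n) a\<^sub>N\<^sub>-\<^sub>n\<close> with
  \<open>\<alpha>\<^sub>n = - (1 - x\<^sub>1) (1 - x\<^sub>2) (x\<^sub>1^n - x\<^sub>2^n) / (x\<^sub>1 - x\<^sub>2)\<close>.  Every \<open>z\<close>-coefficient of \<open>\<alpha>\<^sub>n\<close> is a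
  polynomial in \<open>n\<close> without constant term, and \<open>n^j\<close> only occurs in total degree at least \<open>j + 1\<close>.

  Thus \<open>a\<^sub>N\<close> and \<open>b\<^sub>N\<close> are sums over compositions of \<open>N\<close>, and the product \<open>a\<^sub>N b\<^sub>N\<close> is a sum over pairs
  of compositions.  The parts \<open>w\<^sub>1, \<dots>, w\<^sub>l\<close> of the common refinement become the \<open>v\<^sub>i\<close> of a bi-bracket,
  and the exponents \<open>d\<^sub>i\<close> in the geometric series \<open>q^T / (1 - q^T) = \<Sum>\<^sub>d q^(d T)\<close> at the partial
  sums \<open>T = w\<^sub>1 + \<dots> + w\<^sub>i\<close> become the differences \<open>u\<^sub>i - u\<^sub>i\<^sub>+\<^sub>1\<close>.  A partial sum common to both
  compositions carries \<open>(q^T / (1 - q^T))^2 = \<Sum>\<^sub>d (d - 1) q^(d T)\<close>, which costs one power of \<open>u\<close> but saves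
  one part.  The first part of the refinement is the whole first part of one of the two compositions,
  so \<open>w\<^sub>1\<close> divides each monomial, which is \<open>s\<^sub>1 > 1\<close>.
\<close>

section \<open>Bi-brackets refined by the sum of the \<open>v\<^sub>i\<close>\<close>

text \<open>The series \<open>\<Sum>\<^sub>d\<^sub>\<ge>\<^sub>1 d^e q^(d N)\<close>, with junk value \<open>0\<close> for \<open>N = 0\<close>.\<close>

definition lambert :: "nat \<Rightarrow> nat \<Rightarrow> 'a::comm_ring_1 fps" where
  "lambert e N = Abs_fps (\<lambda>k. if k > 0 \<and> N dvd k then of_nat (k div N) ^ e else 0)"

lemma lambert_nth: "lambert e N $ k = (if k > 0 \<and> N dvd k then of_nat (k div N) ^ e else 0)"
  by (simp add: lambert_def)

lemma lambert_0_right [simp]: "lambert e 0 = 0"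
  by (rule fps_ext) (auto simp: lambert_nth)

text \<open>So \<open>lambert 0 N\<close> is q^N / (1 - q^N). The form without division makes sense
  over every commutative ring, and both rat and \<open>rat fps4\<close> occur below.\<close>

lemma lambert_0_eq:
  assumes "N > 0"
  shows "lambert 0 N * (1 - fps_X ^ N) = (fps_X ^ N :: 'a::comm_ring_1 fps)"
proof (rule fps_ext)
  fix k
  show "(lambert 0 N * (1 - fps_X ^ N)) $ k = (fps_X ^ N :: 'a fps) $ k"
  proof (cases "N dvd k")
    case True
    then obtain d where k: "k = N * d" ..
    show ?thesis
    proof (cases d)
      case (Suc d')
      then have "k - N = N * d'" "\<not> k < N" using k by simp_all
      with k Suc assms show ?thesis
        by (auto simp: right_diff_distrib fps_X_power_mult_right_nth lambert_nth)
    qed (use k assms in \<open>auto simp: right_diff_distrib fps_X_power_mult_right_nth lambert_nth\<close>)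
  next
    case False
    moreover have "\<not> N dvd k - N" if "N \<le> k" using False that by (simp add: dvd_minus_self)
    ultimately show ?thesis
      by (auto simp: right_diff_distrib fps_X_power_mult_right_nth lambert_nth)
  qed
qed

lemma lambert_1_eq:
  assumes "N > 0"
  shows "lambert 1 N * (1 - fps_X ^ N) = (lambert 0 N :: 'a::comm_ring_1 fps)"
proof (rule fps_ext)
  fix k
  show "(lambert 1 N * (1 - fps_X ^ N)) $ k = (lambert 0 N :: 'a fps) $ k"
  proof (cases "N dvd k")
    case True
    then obtain d where k: "k = N * d" ..
    show ?thesis
    proof (cases d)
      case (Suc d')
      then have "k - N = N * d'" "\<not> k < N" using k by simp_all
      with k Suc assms show ?thesis
        by (auto simp: right_diff_distrib fps_X_power_mult_right_nth lambert_nth)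
    qed (use k assms in \<open>auto simp: right_diff_distrib fps_X_power_mult_right_nth lambert_nth\<close>)
  next
    case False
    moreover have "\<not> N dvd k - N" if "N \<le> k" using False that by (simp add: dvd_minus_self)
    ultimately show ?thesis
      by (auto simp: right_diff_distrib fps_X_power_mult_right_nth lambert_nth)
  qed
qed

lemma one_minus_X_power_neq_0:
  assumes "N > 0"
  shows "(1 - fps_X ^ N :: 'a::comm_ring_1 fps) \<noteq> 0"
proof -
  have "(1 - fps_X ^ N :: 'a fps) $ 0 = 1" using assms by simp
  then show ?thesis by (metis fps_zero_nth zero_neq_one)
qed

lemma lambert_0_square:
  "lambert 0 N * lambert 0 N = (lambert 1 N - lambert 0 N :: 'a::idom fps)"
proof (cases "N = 0")
  case False
  let ?q = "1 - fps_X ^ N :: 'a fps"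
  have "lambert 0 N * lambert 0 N * ?q = lambert 0 N * fps_X ^ N"
    using False by (simp add: mult.assoc lambert_0_eq)
  also have "\<dots> = lambert 0 N - lambert 0 N * ?q"
    by (simp add: right_diff_distrib)
  also have "\<dots> = (lambert 1 N - lambert 0 N) * ?q"
    using False lambert_1_eq[of N, where 'a='a] by (simp add: left_diff_distrib)
  finally show ?thesis
    using one_minus_X_power_neq_0[of N, where 'a='a] False by simp
qed simp

section \<open>Bracket sums with prescribed total of the \<open>vs\<close>\<close>

definition seq_index :: "nat \<Rightarrow> nat \<Rightarrow> nat \<Rightarrow> (nat list \<times> nat list) set" where
  "seq_index l N K = {(us, vs) \<in> bi_bracket_index l K. sum_list vs = N}"

text \<open>The factorials of a bi-bracket are left out here; \<open>bracket_seq_sum\<close>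
  restores them as one constant factor.\<close>

definition bracket_term :: "nat list \<Rightarrow> nat list \<Rightarrow> nat list \<Rightarrow> nat list \<Rightarrow> rat" where
  "bracket_term rs ps us vs =
     (\<Prod>i<length ps. of_nat (us ! i) ^ (rs ! i) * of_nat (vs ! i) ^ (ps ! i))"

definition bracket_seq :: "nat list \<Rightarrow> nat list \<Rightarrow> nat \<Rightarrow> rat fps" where
  "bracket_seq rs ps N = Abs_fps (\<lambda>K. \<Sum>(us, vs)\<in>seq_index (length ps) N K.
     bracket_term rs ps us vs)"

text \<open>
  Here \<open>ps\<close> stands for the list of the \<open>s\<^sub>i - 1\<close>: the bound is on the weight of a bi-bracket, and
  \<open>hd ps > 0\<close> says \<open>s\<^sub>1 > 1\<close>.
\<close>

inductive closed_seq :: "int \<Rightarrow> (nat \<Rightarrow> rat fps) \<Rightarrow> bool" for k where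
  zero: "closed_seq k (\<lambda>_. 0)"
| base: "\<lbrakk>length rs = length ps; ps \<noteq> []; hd ps > 0;
    int (sum_list ps + length ps + sum_list rs) \<le> k\<rbrakk> \<Longrightarrow> closed_seq k (bracket_seq rs ps)"
| add: "closed_seq k F \<Longrightarrow> closed_seq k G \<Longrightarrow> closed_seq k (\<lambda>N. F N + G N)"
| scale: "closed_seq k F \<Longrightarrow> closed_seq k (\<lambda>N. fps_const c * F N)"

lemma closed_seq_sum:
  "(\<And>i. i \<in> A \<Longrightarrow> closed_seq k (F i)) \<Longrightarrow> closed_seq k (\<lambda>N. \<Sum>i\<in>A. F i N)"
  by (induction A rule: infinite_finite_induct) (auto intro: closed_seq.intros)

lemma closed_seq_mono:
  assumes "closed_seq k F" "k \<le> k'"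
  shows "closed_seq k' F"
  using assms by (induction rule: closed_seq.induct) (auto intro: closed_seq.intros)

lemma finite_seq_index: "finite (seq_index l N K)"
  unfolding seq_index_def by (rule finite_subset[OF _ finite_bi_bracket_index[of l K]]) auto

lemma seq_index_0_left: "seq_index 0 N K = (if N = 0 \<and> K = 0 then {([], [])} else {})"
  by (auto simp: seq_index_def bi_bracket_index_def)

text \<open>Every entry of \<open>us\<close> is at least 1, so the sum of \<open>vs\<close> is at
  most K. This makes summation over all N finite at each power of q.\<close>

lemma seq_index_eq_empty:
  assumes "K < N"
  shows "seq_index l N K = {}"
proof -
  have "sum_list vs \<le> K" if "(us, vs) \<in> bi_bracket_index l K" for us vs
  proof -
    have "sum_list vs = (\<Sum>i<l. vs ! i)"
      using that by (auto simp: bi_bracket_index_def sum_list_sum_nth atLeast0LessThan)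
    also have "\<dots> \<le> (\<Sum>i<l. us ! i * vs ! i)"
      using that by (intro sum_mono) (auto simp: bi_bracket_index_def Suc_le_eq)
    also have "\<dots> = K" using that by (auto simp: bi_bracket_index_def)
    finally show ?thesis .
  qed
  with assms show ?thesis by (fastforce simp: seq_index_def)
qed

text \<open>Let d and w be the last entries. Subtracting d from the other entries of
  \<open>us\<close> keeps them positive and decreasing, and the exponent drops by exactly d * N
  because \<open>vs\<close> sums to N. Hence d acts as the summation index of a geometric series in
  q^N.\<close>

lemma bij_seq_index_Suc:
  "bij_betw (\<lambda>((d, w), us, vs). (map ((+) d) us @ [d], vs @ [w]))
     (SIGMA (d, w) : {(d, w). 0 < d \<and> d * N \<le> K \<and> 0 < w \<and> w \<le> N}. seq_index l (N - w) (K - d * N))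
     (seq_index (Suc l) N K)"
proof (rule bij_betw_byWitness[where f' =
    "\<lambda>(us, vs). ((last us, last vs), map (\<lambda>x. x - last us) (butlast us), butlast vs)"], goal_cases)
  case 1
  show ?case by (auto simp: comp_def)
next
  case 2
  show ?case
  proof (rule ballI, unfold split_paired_all)
    fix us vs assume a: "(us, vs) \<in> seq_index (Suc l) N K"
    obtain us' d where us: "us = us' @ [d]"
      using a by (cases us rule: rev_cases) (auto simp: seq_index_def bi_bracket_index_def)
    obtain vs' w where vs: "vs = vs' @ [w]"
      using a by (cases vs rule: rev_cases) (auto simp: seq_index_def bi_bracket_index_def)
    have "x > d" if "x \<in> set us'" for x
      using a that us by (auto simp: seq_index_def bi_bracket_index_def sorted_wrt_append)
    then have "map (\<lambda>x. d + (x - d)) us' = us'" by (intro map_idI) (simp add: less_imp_le)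
    then show "(case (case (us, vs) of (us, vs) \<Rightarrow>
        ((last us, last vs), map (\<lambda>x. x - last us) (butlast us), butlast vs)) of
        (x, xa) \<Rightarrow> (case x of (d, w) \<Rightarrow> \<lambda>(us, vs). (map ((+) d) us @ [d], vs @ [w])) xa) = (us, vs)"
      by (simp add: us vs comp_def)
  qed
next
  case 3
  show ?case
  proof (rule image_subsetI, unfold split_paired_all)
    fix d w us vs
    assume "((d, w), us, vs) \<in> (SIGMA (d, w) : {(d, w). 0 < d \<and> d * N \<le> K \<and> 0 < w \<and> w \<le> N}.
      seq_index l (N - w) (K - d * N))"
    then have a: "(us, vs) \<in> seq_index l (N - w) (K - d * N)" "0 < d" "d * N \<le> K" "0 < w" "w \<le> N"
      by auto
    then have len: "length us = l" "length vs = l" and s: "sum_list vs = N - w"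
      and e: "(\<Sum>i<l. us ! i * vs ! i) = K - d * N"
      by (auto simp: seq_index_def bi_bracket_index_def)
    have "(\<Sum>i<l. (d + us ! i) * vs ! i) = d * (N - w) + (K - d * N)"
      using s e len
      by (simp add: add_mult_distrib sum.distrib sum_distrib_left [symmetric] sum_list_sum_nth
          atLeast0LessThan)
    then have "(\<Sum>i<l. (d + us ! i) * vs ! i) + d * w = K"
      using a by (metis add.commute add.left_commute add_mult_distrib2 le_add_diff_inverse)
    then show "(case ((d, w), us, vs) of (x, xa) \<Rightarrow>
        (case x of (d, w) \<Rightarrow> \<lambda>(us, vs). (map ((+) d) us @ [d], vs @ [w])) xa) \<in> seq_index (Suc l) N K"
      using a len s
      by (auto simp: seq_index_def bi_bracket_index_def sorted_wrt_append sorted_wrt_map nth_append)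
  qed
next
  case 4
  show ?case
  proof (rule image_subsetI, unfold split_paired_all)
    fix us vs assume a: "(us, vs) \<in> seq_index (Suc l) N K"
    obtain us' d where us: "us = us' @ [d]"
      using a by (cases us rule: rev_cases) (auto simp: seq_index_def bi_bracket_index_def)
    obtain vs' w where vs: "vs = vs' @ [w]"
      using a by (cases vs rule: rev_cases) (auto simp: seq_index_def bi_bracket_index_def)
    have len: "length us' = l" "length vs' = l" and s: "sum_list vs' + w = N"
      and e: "(\<Sum>i<l. us' ! i * vs' ! i) + d * w = K" and dw: "d > 0" "w > 0"
      using a us vs by (auto simp: seq_index_def bi_bracket_index_def nth_append)
    have gt: "x > d" if "x \<in> set us'" for x
      using a that us by (auto simp: seq_index_def bi_bracket_index_def sorted_wrt_append)
    have "sorted_wrt (>) (map (\<lambda>x. x - d) us')"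
      unfolding sorted_wrt_map
      by (rule sorted_wrt_mono_rel[where P = "(>)"])
        (use a us gt in \<open>auto simp: seq_index_def bi_bracket_index_def sorted_wrt_append less_imp_le intro!: diff_less_mono\<close>)
    moreover have *: "(\<Sum>i<l. (us' ! i - d) * vs' ! i) + d * N = K"
    proof -
      have "(\<Sum>i<l. us' ! i * vs' ! i) = (\<Sum>i<l. (us' ! i - d) * vs' ! i + d * vs' ! i)"
      proof (rule sum.cong)
        fix i assume "i \<in> {..<l}"
        then have "us' ! i > d" using gt len by simp
        then have "us' ! i = (us' ! i - d) + d" by simp
        then show "us' ! i * vs' ! i = (us' ! i - d) * vs' ! i + d * vs' ! i"
          by (metis add_mult_distrib)
      qed simp
      also have "\<dots> = (\<Sum>i<l. (us' ! i - d) * vs' ! i) + d * sum_list vs'"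
        using len by (simp add: sum.distrib sum_distrib_left sum_list_sum_nth atLeast0LessThan)
      finally show ?thesis
        using e s by (auto simp: add_mult_distrib2)
    qed
    ultimately show "(case (us, vs) of (us, vs) \<Rightarrow>
        ((last us, last vs), map (\<lambda>x. x - last us) (butlast us), butlast vs)) \<in>
        (SIGMA (d, w) : {(d, w). 0 < d \<and> d * N \<le> K \<and> 0 < w \<and> w \<le> N}. seq_index l (N - w) (K - d * N))"
      using a us vs len s dw gt
      by (auto simp: seq_index_def bi_bracket_index_def sum.distrib)
  qed
qed

lemma lambert_mult_nth:
  assumes "N > 0"
  shows "(lambert e N * F) $ K = (\<Sum>d\<in>{d. 0 < d \<and> d * N \<le> K}. of_nat d ^ e * F $ (K - d * N))"
proof -
  have "(lambert e N * F) $ K = (\<Sum>k=0..K. lambert e N $ k * F $ (K - k))"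
    by (rule fps_mult_nth)
  also have "\<dots> = (\<Sum>k\<in>(\<lambda>d. d * N) ` {d. 0 < d \<and> d * N \<le> K}. lambert e N $ k * F $ (K - k))"
  proof (rule sum.mono_neutral_right)
    show "\<forall>k\<in>{0..K} - (\<lambda>d. d * N) ` {d. 0 < d \<and> d * N \<le> K}. lambert e N $ k * F $ (K - k) = 0"
    proof
      fix k assume k: "k \<in> {0..K} - (\<lambda>d. d * N) ` {d. 0 < d \<and> d * N \<le> K}"
      have "\<not> (k > 0 \<and> N dvd k)"
      proof
        assume "k > 0 \<and> N dvd k"
        then have "k = (k div N) * N" "k div N > 0" by (auto elim!: dvdE)
        with k show False by auto
      qed
      then show "lambert e N $ k * F $ (K - k) = 0" by (auto simp: lambert_nth)
    qed
  qed auto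
  also have "\<dots> = (\<Sum>d\<in>{d. 0 < d \<and> d * N \<le> K}. of_nat d ^ e * F $ (K - d * N))"
    using assms by (subst sum.reindex) (auto simp: inj_on_def lambert_nth)
  finally show ?thesis .
qed

lemma bracket_seq_nth:
  "bracket_seq rs ps N $ K = (\<Sum>(us, vs)\<in>seq_index (length ps) N K. bracket_term rs ps us vs)"
  by (simp add: bracket_seq_def)

text \<open>Each power of u is expanded as ((d + u) - d)^r. The powers of d that split off are
  gathered in the exponent of the new last entry d.\<close>

lemma bracket_term_shift:
  assumes "length us = length ps" "length vs = length ps" "length rs = length ps"
  shows "of_nat d ^ e * of_nat w ^ p * bracket_term rs ps us vs =
    (\<Sum>t\<in>PiE {..<length ps} (\<lambda>i. {..rs ! i}).
       (\<Prod>i<length ps. of_nat (rs ! i choose t i) * (-1) ^ (rs ! i - t i)) *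
       bracket_term (map t [0..<length ps] @ [e + (\<Sum>i<length ps. rs ! i - t i)]) (ps @ [p])
         (map ((+) d) us @ [d]) (vs @ [w]))"
proof -
  define l where "l = length ps"
  have "bracket_term rs ps us vs =
      (\<Prod>i<l. (of_nat (d + us ! i) + (- of_nat d)) ^ (rs ! i) * of_nat (vs ! i) ^ (ps ! i))"
    by (simp add: bracket_term_def l_def)
  also have "\<dots> = (\<Prod>i<l. \<Sum>t\<le>rs ! i. of_nat (rs ! i choose t) * of_nat (d + us ! i) ^ t *
      (- of_nat d) ^ (rs ! i - t) * of_nat (vs ! i) ^ (ps ! i))"
    by (simp only: binomial_ring sum_distrib_right)
  also have "\<dots> = (\<Sum>t\<in>PiE {..<l} (\<lambda>i. {..rs ! i}). \<Prod>i<l. of_nat (rs ! i choose t i) *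
      of_nat (d + us ! i) ^ t i * (- of_nat d) ^ (rs ! i - t i) * of_nat (vs ! i) ^ (ps ! i))"
    by (rule prod_sum_PiE) auto
  finally have *: "bracket_term rs ps us vs = \<dots>" .
  show ?thesis
    unfolding * sum_distrib_left l_def [symmetric]
  proof (rule sum.cong [OF refl])
    fix t assume "t \<in> PiE {..<l} (\<lambda>i. {..rs ! i})"
    have "bracket_term (map t [0..<l] @ [e + (\<Sum>i<l. rs ! i - t i)]) (ps @ [p])
        (map ((+) d) us @ [d]) (vs @ [w]) =
      (\<Prod>i<l. of_nat (d + us ! i) ^ t i * of_nat (vs ! i) ^ (ps ! i)) *
        (of_nat d ^ (e + (\<Sum>i<l. rs ! i - t i)) * of_nat w ^ p)"
      using assms by (simp add: bracket_term_def l_def nth_append)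
    moreover have "(\<Prod>i<l. of_nat (rs ! i choose t i) * of_nat (d + us ! i) ^ t i *
        (- of_nat d) ^ (rs ! i - t i) * of_nat (vs ! i) ^ (ps ! i)) =
      (\<Prod>i<l. of_nat (rs ! i choose t i) * (-1) ^ (rs ! i - t i)) *
      (\<Prod>i<l. of_nat (d + us ! i) ^ t i * of_nat (vs ! i) ^ (ps ! i)) *
      (of_nat d :: rat) ^ (\<Sum>i<l. rs ! i - t i)"
      unfolding power_sum prod.distrib [symmetric]
      by (rule prod.cong [OF refl]) (subst power_minus, simp only: mult_ac)
    ultimately show "of_nat d ^ e * of_nat w ^ p * (\<Prod>i<l. of_nat (rs ! i choose t i) *
        of_nat (d + us ! i) ^ t i * (- of_nat d) ^ (rs ! i - t i) * of_nat (vs ! i) ^ (ps ! i)) =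
      (\<Prod>i<l. of_nat (rs ! i choose t i) * (-1) ^ (rs ! i - t i)) *
       bracket_term (map t [0..<l] @ [e + (\<Sum>i<l. rs ! i - t i)]) (ps @ [p])
         (map ((+) d) us @ [d]) (vs @ [w])"
      by (simp only: power_add mult_ac)
  qed
qed

text \<open>The bijection \<open>bij_seq_index_Suc\<close> turns a pair (d, w) and a shorter bracket
  into a bracket with one more column; \<open>bracket_term_shift\<close> rewrites the monomials in
  the new entries.\<close>

lemma lambert_mult_bracket_seq:
  assumes "length rs = length ps"
  shows "lambert e N * (\<Sum>w=1..N. of_nat w ^ p * bracket_seq rs ps (N - w)) =
    (\<Sum>t\<in>PiE {..<length ps} (\<lambda>i. {..rs ! i}).
       fps_const (\<Prod>i<length ps. of_nat (rs ! i choose t i) * (-1) ^ (rs ! i - t i)) *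
       bracket_seq (map t [0..<length ps] @ [e + (\<Sum>i<length ps. rs ! i - t i)]) (ps @ [p]) N)"
  (is "?L = (\<Sum>t\<in>?T. fps_const (?c t) * bracket_seq (?rs t) _ N)")
proof (cases "N = 0")
  case True
  \<comment> \<open>Positive entries cannot sum to 0, so the right side vanishes at N = 0, in
    agreement with the default \<open>lambert e 0 = 0\<close>.\<close>
  have "seq_index (Suc l) 0 K = {}" for l K
  proof -
    have False if "(us, vs) \<in> seq_index (Suc l) 0 K" for us vs
      using that by (cases vs) (auto simp: seq_index_def bi_bracket_index_def)
    then show ?thesis by auto
  qed
  then have "bracket_seq (?rs t) (ps @ [p]) 0 = 0" for t
    by (intro fps_ext) (simp add: bracket_seq_nth)
  then show ?thesis using True by simp
next
  case False
  define l where "l = length ps"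
  show ?thesis
  proof (rule fps_ext)
    fix K
    define DW where "DW = {(d, w). 0 < d \<and> d * N \<le> K \<and> 0 < w \<and> w \<le> N}"
    have DW: "DW = {d. 0 < d \<and> d * N \<le> K} \<times> {1..N}" by (auto simp: DW_def)
    have "{d. 0 < d \<and> d * N \<le> K} \<subseteq> {..K}"
    proof safe
      fix d assume "d * N \<le> K"
      moreover have "d \<le> d * N" using False by simp
      ultimately show "d \<le> K" by linarith
    qed
    then have fin: "finite {d. 0 < d \<and> d * N \<le> K}" by (rule finite_subset) simp
    have "?L $ K = (\<Sum>d\<in>{d. 0 < d \<and> d * N \<le> K}. \<Sum>w=1..N. of_nat d ^ e * of_nat w ^ p *
        bracket_seq rs ps (N - w) $ (K - d * N))"
      using False by (simp add: lambert_mult_nth fps_sum_nth sum_distrib_left mult.assoc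
          fps_of_nat [symmetric] fps_const_power sum.swap[of _ _ "{Suc 0..N}"] del: of_nat_power)
    also have "\<dots> = (\<Sum>(d, w)\<in>DW. of_nat d ^ e * of_nat w ^ p *
        bracket_seq rs ps (N - w) $ (K - d * N))"
      unfolding DW by (rule sum.cartesian_product)
    also have "\<dots> = (\<Sum>(d, w)\<in>DW. \<Sum>(us, vs)\<in>seq_index l (N - w) (K - d * N).
        of_nat d ^ e * of_nat w ^ p * bracket_term rs ps us vs)"
      by (simp add: bracket_seq_nth l_def sum_distrib_left case_prod_unfold)
    also have "\<dots> = (\<Sum>((d, w), us, vs)\<in>(SIGMA (d, w) : DW. seq_index l (N - w) (K - d * N)).
        of_nat d ^ e * of_nat w ^ p * bracket_term rs ps us vs)"
      unfolding case_prod_unfold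
      by (subst sum.Sigma) (use fin in \<open>auto simp: DW finite_seq_index case_prod_unfold\<close>)
    also have "\<dots> = (\<Sum>((d, w), us, vs)\<in>(SIGMA (d, w) : DW. seq_index l (N - w) (K - d * N)).
        \<Sum>t\<in>?T. ?c t * bracket_term (?rs t) (ps @ [p]) (map ((+) d) us @ [d]) (vs @ [w]))"
      by (rule sum.cong [OF refl])
        (auto simp: seq_index_def bi_bracket_index_def l_def assms intro!: bracket_term_shift)
    also have "\<dots> = (\<Sum>(us, vs)\<in>seq_index (Suc l) N K.
        \<Sum>t\<in>?T. ?c t * bracket_term (?rs t) (ps @ [p]) us vs)"
      by (subst sum.reindex_bij_betw [OF bij_seq_index_Suc, symmetric])
        (simp add: DW_def case_prod_unfold)
    also have "\<dots> = (\<Sum>t\<in>?T. ?c t * (\<Sum>(us, vs)\<in>seq_index (Suc l) N K.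
        bracket_term (?rs t) (ps @ [p]) us vs))"
      unfolding case_prod_unfold sum_distrib_left by (rule sum.swap)
    also have "\<dots> = (\<Sum>t\<in>?T. fps_const (?c t) * bracket_seq (?rs t) (ps @ [p]) N) $ K"
      by (simp add: fps_sum_nth bracket_seq_nth l_def)
    finally show "?L $ K = \<dots>" .
  qed
qed

text \<open>The binomial expansion only moves exponents: t i stays with the old column and r - t i
  goes to the new one. The weight therefore grows by just p + 1 and e.\<close>

lemma closed_seq_lambert_bracket_seq:
  assumes "length rs = length ps" "hd (ps @ [p]) > 0"
    "int (sum_list ps + length ps + sum_list rs + p + 1 + e) \<le> k"
  shows "closed_seq k (\<lambda>N. lambert e N * (\<Sum>w=1..N. of_nat w ^ p * bracket_seq rs ps (N - w)))"
  unfolding lambert_mult_bracket_seq [OF assms(1)]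
proof (intro closed_seq_sum closed_seq.scale closed_seq.base)
  fix t assume t: "t \<in> PiE {..<length ps} (\<lambda>i. {..rs ! i})"
  have "sum_list (map t [0..<length ps]) + (\<Sum>i<length ps. rs ! i - t i) =
      (\<Sum>i<length ps. t i + (rs ! i - t i))"
    by (simp add: sum.distrib sum_list_sum_nth atLeast0LessThan)
  also have "\<dots> = (\<Sum>i<length ps. rs ! i)"
    using t by (intro sum.cong) (auto simp: PiE_def Pi_def)
  also have "\<dots> = sum_list rs"
    using assms(1) by (simp add: sum_list_sum_nth atLeast0LessThan)
  finally have *: "sum_list (map t [0..<length ps]) + (\<Sum>i<length ps. rs ! i - t i) = sum_list rs" .
  show "int (sum_list (ps @ [p]) + length (ps @ [p]) +
      sum_list (map t [0..<length ps] @ [e + (\<Sum>i<length ps. rs ! i - t i)])) \<le> k"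
    using assms(3) unfolding * [symmetric] by (simp add: add_ac)
qed (use assms(2) in auto)

section \<open>Sequences with an open last block\<close>

text \<open>
  A sequence is open if its last block of parts \<open>v\<close> has not yet received its value \<open>u\<close>, which a
  factor \<open>lambert e\<close> provides.
\<close>

definition open_seq :: "int \<Rightarrow> (nat \<Rightarrow> rat fps) \<Rightarrow> bool" where
  "open_seq k F \<longleftrightarrow> (\<forall>e. closed_seq (k + int e) (\<lambda>N. lambert e N * F N))"

lemma open_seq_zero: "open_seq k (\<lambda>_. 0)"
  by (simp add: open_seq_def closed_seq.zero)

lemma open_seq_add: "open_seq k F \<Longrightarrow> open_seq k G \<Longrightarrow> open_seq k (\<lambda>N. F N + G N)"
  by (simp add: open_seq_def distrib_left closed_seq.add)

lemma open_seq_scale: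
  assumes "open_seq k F"
  shows "open_seq k (\<lambda>N. fps_const c * F N)"
  unfolding open_seq_def
proof
  fix e
  have "closed_seq (k + int e) (\<lambda>N. fps_const c * (lambert e N * F N))"
    using assms by (auto simp: open_seq_def intro: closed_seq.scale)
  then show "closed_seq (k + int e) (\<lambda>N. lambert e N * (fps_const c * F N))"
    by (simp only: mult.left_commute)
qed

lemma open_seq_mono: "open_seq k F \<Longrightarrow> k \<le> k' \<Longrightarrow> open_seq k' F"
  unfolding open_seq_def by (meson add_right_mono closed_seq_mono)

text \<open>This is the case of a single column: the empty bracket is concentrated at 0, so only w =
  N survives in the convolution. The assumption \<open>p > 0\<close> becomes the condition that the
  first upper entry exceeds 1.\<close>

lemma open_seq_power:
  assumes "p > 0" "int p + 1 \<le> k"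
  shows "open_seq k (\<lambda>N. of_nat N ^ p)"
  unfolding open_seq_def
proof
  fix e
  have "bracket_seq [] [] M = (if M = 0 then 1 else 0)" for M
    by (rule fps_ext) (simp add: bracket_seq_nth seq_index_0_left bracket_term_def)
  then have "(\<Sum>w=1..N. of_nat w ^ p * bracket_seq [] [] (N - w)) = of_nat N ^ p" for N
    using assms(1) by (cases N) (auto simp: if_distrib sum.delta cong: if_cong)
  moreover have "closed_seq (k + int e)
      (\<lambda>N. lambert e N * (\<Sum>w=1..N. of_nat w ^ p * bracket_seq [] [] (N - w)))"
    by (rule closed_seq_lambert_bracket_seq) (use assms in auto)
  ultimately show "closed_seq (k + int e) (\<lambda>N. lambert e N * of_nat N ^ p)" by simp
qed

text \<open>A new part w with exponent p brings an upper entry p + 1. Here p = 0 is allowed, since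
  the first column is already present in F.\<close>

lemma open_seq_conv:
  assumes "closed_seq k F"
  shows "open_seq (k + int p + 1) (\<lambda>N. \<Sum>w=1..N. of_nat w ^ p * F (N - w))"
  using assms
proof induction
  case zero
  show ?case by (simp add: open_seq_zero)
next
  case (base rs ps)
  show ?case
    unfolding open_seq_def
    by (intro allI closed_seq_lambert_bracket_seq) (use base in auto)
next
  case (add F G)
  then show ?case by (simp add: distrib_left sum.distrib open_seq_add)
next
  case (scale F c)
  then have "open_seq (k + int p + 1)
      (\<lambda>N. fps_const c * (\<Sum>w=1..N. of_nat w ^ p * F (N - w)))"
    by (intro open_seq_scale)
  then show ?case by (simp add: sum_distrib_left mult.left_commute)
qed

section \<open>From bracket sequences to the span of bi-brackets\<close>

interpretation rat_fps: vector_space "\<lambda>(c::rat) (f::rat fps). fps_const c * f"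
  by (rule vector_space_rat_fps)

text \<open>Summation over N removes the constraint on \<open>vs\<close>. Stopping at N = K loses
  nothing at q^K by \<open>seq_index_eq_empty\<close>.\<close>

lemma bracket_seq_sum:
  assumes "length rs = length ps"
  shows "Abs_fps (\<lambda>K. \<Sum>N\<le>K. bracket_seq rs ps N $ K) =
    fps_const (\<Prod>i<length ps. fact (rs ! i) * fact (ps ! i)) * bi_bracket (map Suc ps) rs"
proof (rule fps_ext)
  fix K
  let ?I = "bi_bracket_index (length ps) K"
  have "(\<Sum>N\<le>K. bracket_seq rs ps N $ K) =
      (\<Sum>x\<in>(SIGMA N : {..K}. seq_index (length ps) N K). bracket_term rs ps (fst (snd x)) (snd (snd x)))"
    unfolding bracket_seq_nth case_prod_unfold
    by (subst sum.Sigma) (auto simp: finite_seq_index case_prod_unfold)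
  also have "\<dots> = (\<Sum>x\<in>?I. bracket_term rs ps (fst x) (snd x))"
  proof (rule sum.reindex_bij_witness[where i = "\<lambda>(us, vs). (sum_list vs, us, vs)" and j = snd])
    fix x assume "x \<in> ?I"
    then have "x \<in> seq_index (length ps) (sum_list (snd x)) K"
      by (auto simp: seq_index_def)
    with seq_index_eq_empty[of K "sum_list (snd x)" "length ps"]
    show "(case x of (us, vs) \<Rightarrow> (sum_list vs, us, vs)) \<in> (SIGMA N : {..K}. seq_index (length ps) N K)"
      by (cases x) (auto simp: not_less [symmetric])
  qed (auto simp: seq_index_def)
  also have "\<dots> = (\<Sum>x\<in>?I. (\<Prod>i<length ps. fact (rs ! i) * fact (ps ! i)) *
      (\<Prod>i<length ps. of_nat (fst x ! i) ^ (rs ! i) / fact (rs ! i) *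
       (of_nat (snd x ! i) ^ (map Suc ps ! i - 1) / fact (map Suc ps ! i - 1))))"
    unfolding bracket_term_def prod.distrib [symmetric]
    by (intro sum.cong prod.cong refl) simp
  also have "\<dots> = (fps_const (\<Prod>i<length ps. fact (rs ! i) * fact (ps ! i)) *
      bi_bracket (map Suc ps) rs) $ K"
    by (simp add: bi_bracket_def sum_distrib_left case_prod_unfold)
  finally show "Abs_fps (\<lambda>K. \<Sum>N\<le>K. bracket_seq rs ps N $ K) $ K = \<dots>" by simp
qed

lemma closed_seq_sum_in_qBD_upto:
  assumes "closed_seq (int k) F"
  shows "Abs_fps (\<lambda>K. \<Sum>N\<le>K. F N $ K) \<in> qBD_upto k"
  using assms
proof induction
  case zero
  then show ?case
    by (simp add: qBD_upto_def rat_span_def fps_zero_def [symmetric] rat_fps.span_zero)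
next
  case (base rs ps)
  have "bi_bracket (map Suc ps) rs \<in> qBD_upto k"
    unfolding qBD_upto_def rat_span_def
  proof (rule rat_fps.span_base, safe, intro exI conjI)
    show "bi_admissible (map Suc ps) rs"
      using base by (cases ps) (auto simp: bi_admissible_def)
    have "sum_list (map Suc ps) = sum_list ps + length ps" by (induction ps) auto
    then show "bi_weight (map Suc ps) rs \<le> k"
      using base by (simp add: bi_weight_def)
  qed (rule refl)
  then show ?case
    using base by (simp add: bracket_seq_sum qBD_upto_def rat_span_def rat_fps.span_scale)
next
  case (add F G)
  have "Abs_fps (\<lambda>K. \<Sum>N\<le>K. (F N + G N) $ K) =
      Abs_fps (\<lambda>K. \<Sum>N\<le>K. F N $ K) + Abs_fps (\<lambda>K. \<Sum>N\<le>K. G N $ K)"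
    by (rule fps_ext) (simp add: sum.distrib)
  with add show ?case
    by (simp add: qBD_upto_def rat_span_def rat_fps.span_add)
next
  case (scale F c)
  have "Abs_fps (\<lambda>K. \<Sum>N\<le>K. (fps_const c * F N) $ K) =
      fps_const c * Abs_fps (\<lambda>K. \<Sum>N\<le>K. F N $ K)"
    by (rule fps_ext) (simp add: sum_distrib_left)
  with scale show ?case
    by (simp add: qBD_upto_def rat_span_def rat_fps.span_scale)
qed

section \<open>The coefficient of \<open>y^0\<close>\<close>

text \<open>
  Two embeddings of \<open>R[[q]][[y]]\<close> into \<open>R((y))[[q]]\<close>: the obvious one, and the one sending \<open>y\<close> to \<open>q / y\<close>.
\<close>

definition subst_y :: "'a::comm_ring_1 fps fps \<Rightarrow> 'a fls fps" where
  "subst_y F = Abs_fps (\<lambda>k. fps_to_fls (Abs_fps (\<lambda>N. F $ N $ k)))"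

definition subst_y_inv :: "'a::comm_ring_1 fps fps \<Rightarrow> 'a fls fps" where
  "subst_y_inv F = Abs_fps (\<lambda>k. \<Sum>N\<le>k. fls_const (F $ N $ (k - N)) * fls_X_inv ^ N)"

lemma subst_y_mult: "subst_y (F * G) = subst_y F * subst_y G"
proof (rule fps_ext)
  fix k
  have "(subst_y F * subst_y G) $ k =
      fps_to_fls (\<Sum>j=0..k. Abs_fps (\<lambda>N. F $ N $ j) * Abs_fps (\<lambda>N. G $ N $ (k - j)))"
    by (rule fls_eqI)
      (auto simp: subst_y_def fps_mult_nth fls_times_fps_to_fls [symmetric] fls_nth_sum fps_sum_nth)
  moreover have "(\<Sum>j=0..k. Abs_fps (\<lambda>N. F $ N $ j) * Abs_fps (\<lambda>N. G $ N $ (k - j))) =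
      Abs_fps (\<lambda>N. (F * G) $ N $ k)"
    by (rule fps_ext) (simp add: fps_sum_nth fps_mult_nth sum.swap [of _ "{0..k}"])
  ultimately show "subst_y (F * G) $ k = (subst_y F * subst_y G) $ k"
    by (simp add: subst_y_def)
qed

lemma fls_const_sum: "fls_const (\<Sum>x\<in>A. f x) = (\<Sum>x\<in>A. fls_const (f x))"
  by (rule fls_eqI) (auto simp: fls_nth_sum)

lemma subst_y_inv_mult: "subst_y_inv (F * G) = subst_y_inv F * subst_y_inv G"
proof (rule fps_ext)
  fix k
  \<comment> \<open>The y-exponents are a and b, the q-exponents c and d, with total k. One side
    groups by N = a + b, the other by j = a + c; the reindexing below passes from one to the
    other.\<close>
  define T where "T = (\<lambda>a c b d. fls_const (F $ a $ c * G $ b $ d) * fls_X_inv ^ (a + b))"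
  have "subst_y_inv (F * G) $ k =
      (\<Sum>N\<le>k. \<Sum>a\<le>N. \<Sum>c\<le>k - N. T a c (N - a) (k - N - c))"
    by (simp add: subst_y_inv_def T_def fps_mult_nth fps_sum_nth sum_distrib_right fls_const_sum
        atLeast0AtMost)
  also have "\<dots> = (\<Sum>(N, a, c)\<in>(SIGMA N : {..k}. SIGMA a : {..N}. {..k - N}).
      T a c (N - a) (k - N - c))"
    by (simp add: sum.Sigma)
  also have "\<dots> = (\<Sum>(j, a, b)\<in>(SIGMA j : {..k}. SIGMA a : {..j}. {..k - j}).
      T a (j - a) b (k - j - b))"
    by (rule sum.reindex_bij_witness[where i = "\<lambda>(j, a, b). (a + b, a, j - a)"
        and j = "\<lambda>(N, a, c). (a + c, a, N - a)"]) (auto simp: algebra_simps)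
  also have "\<dots> = (\<Sum>j\<le>k. \<Sum>a\<le>j. \<Sum>b\<le>k - j. T a (j - a) b (k - j - b))"
    by (simp add: sum.Sigma)
  also have "\<dots> = (subst_y_inv F * subst_y_inv G) $ k"
    by (simp add: subst_y_inv_def T_def fps_mult_nth sum_product atLeast0AtMost power_add
        fls_const_mult_const [symmetric] mult_ac del: fls_const_mult_const)
  finally show "subst_y_inv (F * G) $ k = (subst_y_inv F * subst_y_inv G) $ k" .
qed

text \<open>Only y^N against (q / y)^N contributes to y^0, and it leaves q^N behind; hence the bound
  N \<le> k.\<close>

lemma subst_y_mult_subst_y_inv_nth:
  "(subst_y F * subst_y_inv G) $ k $$ 0 = (\<Sum>N\<le>k. (fps_X ^ N * F $ N * G $ N) $ k)"
proof -
  have [simp]: "(fps_to_fls f * (fls_const g * fls_X_inv ^ n)) $$ 0 = f $ n * g" for f :: "'a fps" and g n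
    by (subst mult.assoc [symmetric], subst fls_X_inv_power_times_conv_shift(2)) simp
  have "(subst_y F * subst_y_inv G) $ k $$ 0 = (\<Sum>j\<le>k. \<Sum>N\<le>k - j. F $ N $ j * G $ N $ (k - j - N))"
    by (simp add: fps_mult_nth fls_nth_sum subst_y_def subst_y_inv_def sum_distrib_left
        atLeast0AtMost)
  also have "\<dots> = (\<Sum>(j, N)\<in>(SIGMA j : {..k}. {..k - j}). F $ N $ j * G $ N $ (k - j - N))"
    by (simp add: sum.Sigma)
  also have "\<dots> = (\<Sum>(N, j)\<in>(SIGMA N : {..k}. {..k - N}). F $ N $ j * G $ N $ (k - N - j))"
    by (rule sum.reindex_bij_witness[where i = "\<lambda>(a, b). (b, a)" and j = "\<lambda>(a, b). (b, a)"])
      (auto simp: algebra_simps)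
  also have "\<dots> = (\<Sum>N\<le>k. (fps_X ^ N * F $ N * G $ N) $ k)"
    unfolding mult.assoc fps_X_power_mult_nth
    by (subst sum.Sigma [symmetric]) (simp_all add: fps_mult_nth atLeast0AtMost)
  finally show ?thesis .
qed

section \<open>Series expansion of the infinite products\<close>

text \<open>The coefficients of \<open>(c y)\<^sub>\<infinity>\<close>, read off from \<open>(c y)\<^sub>\<infinity> = (1 - c y) (c y q)\<^sub>\<infinity>\<close>.\<close>

fun euler_coeff :: "'a::comm_ring_1 \<Rightarrow> nat \<Rightarrow> 'a fps" where
  "euler_coeff c 0 = 1"
| "euler_coeff c (Suc N) = - (fps_const c * fps_X ^ N * (1 + lambert 0 (Suc N)) * euler_coeff c N)"

definition euler_series :: "'a::comm_ring_1 \<Rightarrow> 'a fps fps" where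
  "euler_series c = Abs_fps (euler_coeff c)"

text \<open>This is the substitution of q y for y.\<close>

definition q_shift :: "'a::comm_ring_1 fps fps \<Rightarrow> 'a fps fps" where
  "q_shift F = Abs_fps (\<lambda>N. fps_X ^ N * F $ N)"

lemma q_shift_mult: "q_shift (F * G) = q_shift F * q_shift G"
proof (rule fps_ext)
  fix N
  have "fps_X ^ N * (F $ i * G $ (N - i)) = fps_X ^ i * F $ i * (fps_X ^ (N - i) * G $ (N - i))"
    if "i \<le> N" for i
  proof -
    have "fps_X ^ N = fps_X ^ i * (fps_X ^ (N - i) :: 'a fps)"
      using that by (simp flip: power_add)
    then show ?thesis by (simp only: mult_ac)
  qed
  then show "q_shift (F * G) $ N = (q_shift F * q_shift G) $ N"
    by (simp add: q_shift_def fps_mult_nth sum_distrib_left)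
qed

lemma one_plus_lambert_0_inverse:
  "N > 0 \<Longrightarrow> (1 - fps_X ^ N) * (1 + lambert 0 N) = (1 :: 'a::comm_ring_1 fps)"
  using lambert_0_eq[of N, where 'a='a] by (simp add: distrib_left mult.commute)

lemma euler_series_eq:
  "euler_series c = (1 - fps_const (fps_const c) * fps_X) * q_shift (euler_series c)"
proof (rule fps_ext)
  fix N
  show "euler_series c $ N = ((1 - fps_const (fps_const c) * fps_X) * q_shift (euler_series c)) $ N"
  proof (cases N)
    case (Suc n)
    have "euler_coeff c (Suc n) - fps_X ^ Suc n * euler_coeff c (Suc n) =
        - (fps_const c * fps_X ^ n * ((1 - fps_X ^ Suc n) * (1 + lambert 0 (Suc n))) * euler_coeff c n)"
      by (simp add: algebra_simps)
    also have "\<dots> = - (fps_const c * fps_X ^ n * euler_coeff c n)"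
      by (simp add: one_plus_lambert_0_inverse del: power_Suc)
    finally have "euler_coeff c (Suc n) = fps_X ^ Suc n * euler_coeff c (Suc n) -
        fps_const c * (fps_X ^ n * euler_coeff c n)"
      by (simp only: diff_eq_eq) (simp only: mult.assoc add.commute diff_conv_add_uminus)
    then show ?thesis
      using Suc by (simp add: euler_series_def q_shift_def left_diff_distrib mult.assoc
          del: euler_coeff.simps)
  qed (simp add: euler_series_def q_shift_def left_diff_distrib mult.assoc)
qed

lemma euler_series_nth_0 [simp]: "euler_series c $ 0 = 1"
  by (simp add: euler_series_def)

text \<open>Here \<Theta> stands for either embedding. Iterating \<open>euler_series_eq\<close>
  splits off the factors of the product one at a time, and the remainder tends to 1 in the q-adic
  topology; this continuity is what \<open>close\<close> provides.\<close>

lemma qpoch_inf_eq_euler_series: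
  fixes \<Theta> :: "'a::idom fps fps \<Rightarrow> 'a fls fps"
  assumes mult: "\<And>F G. \<Theta> (F * G) = \<Theta> F * \<Theta> G"
    and lin: "\<And>c n. \<Theta> (1 - fps_const (fps_const c * fps_X ^ n) * fps_X) =
      1 - fps_const (fls_const c) * t * fps_X ^ n"
    and close: "\<And>F n k. F $ 0 = 1 \<Longrightarrow> (\<And>N j. N > 0 \<Longrightarrow> j < n \<Longrightarrow> F $ N $ j = 0) \<Longrightarrow>
      k < n \<Longrightarrow> \<Theta> F $ k = 1 $ k"
    and t: "(fps_const (fls_const c) * t) $ 0 \<noteq> 1"
  shows "qpoch_inf (fps_const (fls_const c) * t) = \<Theta> (euler_series c)"
proof -
  define a where "a = fps_const (fls_const c) * t"
  \<comment> \<open>The Euler series at q^n y, that is, the remainder after n factors.\<close>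
  define e where "e = (\<lambda>n. Abs_fps (\<lambda>N. fps_X ^ (n * N) * euler_series c $ N))"
  have e_Suc: "e (Suc n) = q_shift (e n)" for n
    by (rule fps_ext) (simp add: e_def q_shift_def power_add mult.assoc)
  have e_0: "e 0 = euler_series c" by (rule fps_ext) (simp add: e_def)
  have e_eq: "e n = (1 - fps_const (fps_const c * fps_X ^ n) * fps_X) * e (Suc n)" for n
  proof (induction n)
    case 0
    show ?case using euler_series_eq[of c] by (simp add: e_Suc e_0)
  next
    case (Suc n)
    have "q_shift (1 - fps_const (fps_const c * fps_X ^ n) * fps_X) =
        1 - fps_const (fps_const c * fps_X ^ Suc n) * fps_X"
      by (rule fps_ext) (auto simp: q_shift_def fps_X_def mult_ac)
    with Suc.IH show ?case
      by (metis e_Suc q_shift_mult)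
  qed
  have prod: "\<Theta> (euler_series c) = (\<Prod>i<n. 1 - a * fps_X ^ i) * \<Theta> (e n)" for n
  proof (induction n)
    case 0
    show ?case by (simp add: e_0)
  next
    case (Suc n)
    have "\<Theta> (e n) = (1 - a * fps_X ^ n) * \<Theta> (e (Suc n))"
      by (subst e_eq) (simp add: mult lin a_def)
    with Suc.IH show ?case by (simp add: mult.assoc)
  qed
  have "(\<lambda>n. \<Prod>i<n. 1 - a * fps_X ^ i) \<longlonglongrightarrow> \<Theta> (euler_series c)"
  proof (rule tendsto_fpsI)
    fix k
    have "(\<Prod>i<n. 1 - a * fps_X ^ i) $ k = \<Theta> (euler_series c) $ k" if "n > k" for n
    proof -
      \<comment> \<open>For N > 0 the coefficient of y^N in \<open>e n\<close> is divisible by q^n,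
        and k < n.\<close>
      have "\<Theta> (e n) $ j = 1 $ j" if "j \<le> k" for j
        by (rule close[of _ n])
          (use that \<open>n > k\<close> in \<open>auto simp: e_def fps_X_power_mult_nth
            intro: less_le_trans[of _ n]\<close>)
      then have "\<Theta> (euler_series c) $ k = ((\<Prod>i<n. 1 - a * fps_X ^ i) * 1) $ k"
        unfolding prod[of n] fps_mult_nth by (intro sum.cong) auto
      then show ?thesis by simp
    qed
    then show "\<forall>\<^sub>F n in sequentially. (\<Prod>i<n. 1 - a * fps_X ^ i) $ k = \<Theta> (euler_series c) $ k"
      by (auto simp: eventually_at_top_dense)
  qed
  moreover have "(\<lambda>n. \<Prod>i<n. 1 - a * fps_X ^ i) \<longlonglongrightarrow> qpoch_inf a"
    by (rule has_prod_imp_tendsto'[OF has_prod_qpoch_inf]) (use t in \<open>simp add: a_def\<close>)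
  ultimately show ?thesis
    unfolding a_def by (rule LIMSEQ_unique[symmetric])
qed

lemma subst_y_1: "subst_y 1 = 1"
  by (intro fps_ext fls_eqI) (auto simp: subst_y_def)

lemma subst_y_inv_nth_eq_1:
  assumes "\<And>N. F $ N $ (k - N) = (if N = 0 \<and> k = 0 then 1 else 0)"
  shows "subst_y_inv F $ k = 1 $ k"
proof -
  have "subst_y_inv F $ k = (\<Sum>N\<le>k. if N = 0 then (if k = 0 then 1 else 0) else 0)"
    unfolding subst_y_inv_def fps_nth_Abs_fps assms by (intro sum.cong) auto
  then show ?thesis by (simp add: sum.delta)
qed

lemma subst_y_inv_1: "subst_y_inv 1 = 1"
  by (intro fps_ext subst_y_inv_nth_eq_1) auto

lemma qpoch_inf_Y_eq:
  "qpoch_inf (embed_coeff c * Y) = subst_y (euler_series c)"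
  unfolding embed_coeff_def
proof (rule qpoch_inf_eq_euler_series[where \<Theta> = subst_y and t = Y, OF subst_y_mult])
  fix c :: "rat fps4" and n
  show "subst_y (1 - fps_const (fps_const c * fps_X ^ n) * fps_X) =
      1 - fps_const (fls_const c) * Y * fps_X ^ n"
    by (intro fps_ext fls_eqI) (auto simp: subst_y_def Y_def fls_X_times_conv_shift)
next
  fix F :: "rat fps4 fps fps" and n k :: nat
  assume *: "F $ 0 = 1" "\<And>N j. N > 0 \<Longrightarrow> j < n \<Longrightarrow> F $ N $ j = 0" "k < n"
  have "F $ N $ k = (if N = 0 \<and> k = 0 then 1 else 0)" for N
    using * by (cases "N = 0") auto
  then show "subst_y F $ k = 1 $ k"
    by (intro fls_eqI) (auto simp: subst_y_def)
qed (use Y_times_neq_1 in \<open>simp add: embed_coeff_def\<close>)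

lemma qpoch_inf_Y_inv_eq:
  "qpoch_inf (embed_coeff c * Y_inv * fps_X) = subst_y_inv (euler_series c)"
  unfolding embed_coeff_def mult.assoc
proof (rule qpoch_inf_eq_euler_series[where \<Theta> = subst_y_inv and t = "Y_inv * fps_X", OF subst_y_inv_mult])
  fix c :: "rat fps4" and n
  show "subst_y_inv (1 - fps_const (fps_const c * fps_X ^ n) * fps_X) =
      1 - fps_const (fls_const c) * (Y_inv * fps_X) * fps_X ^ n"
  proof (rule fps_ext)
    fix k
    have "subst_y_inv (1 - fps_const (fps_const c * fps_X ^ n) * fps_X) $ k =
        (\<Sum>N\<le>k. (if N = 0 then (if k = 0 then 1 else 0) else 0) + (if N = 1 then
          (if k = Suc n then - fls_const c * fls_X_inv else 0) else 0))"
      unfolding subst_y_inv_def fps_nth_Abs_fps by (intro sum.cong refl) auto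
    also have "\<dots> = (if k = 0 then 1 else if k = Suc n then - fls_const c * fls_X_inv else 0)"
      unfolding sum.distrib by (auto simp: sum.delta)
    also have "\<dots> = (1 - fps_const (fls_const c) * (Y_inv * fps_X) * fps_X ^ n) $ k"
      by (auto simp: Y_inv_def mult.assoc simp flip: power_Suc)
    finally show "subst_y_inv (1 - fps_const (fps_const c * fps_X ^ n) * fps_X) $ k = \<dots>" .
  qed
next
  fix F :: "rat fps4 fps fps" and n k :: nat
  assume *: "F $ 0 = 1" "\<And>N j. N > 0 \<Longrightarrow> j < n \<Longrightarrow> F $ N $ j = 0" "k < n"
  have "F $ N $ (k - N) = (if N = 0 \<and> k = 0 then 1 else 0)" for N
    using * by (cases "N = 0") auto
  then show "subst_y_inv F $ k = 1 $ k" by (rule subst_y_inv_nth_eq_1)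
qed simp

section \<open>The quotient of the four products and its recurrence\<close>

definition euler_inverse :: "'a::comm_ring_1 \<Rightarrow> 'a fps fps" where
  "euler_inverse c = fps_right_inverse (euler_series c) 1"

lemma euler_inverse: "euler_series c * euler_inverse c = 1"
  unfolding euler_inverse_def by (rule fps_right_inverse) simp

lemma right_inverse_unique:
  fixes a b c :: "'a::comm_monoid_mult"
  assumes "a * b = 1" "a * c = 1"
  shows "b = c"
proof -
  have "b = b * (a * c)" by (simp add: assms)
  also have "\<dots> = a * b * c" by (simp only: mult_ac)
  finally show ?thesis by (simp add: assms)
qed

lemma inverse_qpoch_inf_Y_eq:
  "inverse (qpoch_inf (embed_coeff c * Y)) = subst_y (euler_inverse c)"
proof -
  have "qpoch_inf (embed_coeff c * Y) * subst_y (euler_inverse c) = 1"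
    by (simp add: qpoch_inf_Y_eq subst_y_mult [symmetric] euler_inverse subst_y_1)
  with qpoch_inf_Y_inverse[of c] show ?thesis by (rule right_inverse_unique)
qed

lemma inverse_qpoch_inf_Y_inv_eq:
  "inverse (qpoch_inf (embed_coeff c * Y_inv * fps_X)) = subst_y_inv (euler_inverse c)"
proof -
  have "qpoch_inf (embed_coeff c * Y_inv * fps_X) * subst_y_inv (euler_inverse c) = 1"
    by (simp add: qpoch_inf_Y_inv_eq subst_y_inv_mult [symmetric] euler_inverse subst_y_inv_1)
  with qpoch_inf_Y_inv_inverse[of c] show ?thesis by (rule right_inverse_unique)
qed

text \<open>The arguments are the two exponentials; the formal variable y is the outer variable of
  the series.\<close>

definition ratio_series :: "'a::comm_ring_1 \<Rightarrow> 'a \<Rightarrow> 'a fps fps" where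
  "ratio_series x y = euler_series (x * y) * euler_series 1 * euler_inverse x * euler_inverse y"

lemma gen_series_eq:
  "gen_series = subst_y (ratio_series exp_z1 exp_z2) * subst_y_inv (ratio_series exp_v1 exp_v2)"
proof -
  have [simp]: "embed_coeff c * embed_coeff d = embed_coeff (c * d)" for c d
    by (simp add: embed_coeff_def)
  have 1: "qpoch_inf Y = subst_y (euler_series 1)"
    using qpoch_inf_Y_eq[of 1] by (simp add: embed_coeff_def)
  have 2: "qpoch_inf (Y_inv * fps_X) = subst_y_inv (euler_series 1)"
    using qpoch_inf_Y_inv_eq[of 1] by (simp add: embed_coeff_def)
  show ?thesis
    unfolding gen_series_def Let_def inverse_qpoch_inf_Y_eq inverse_qpoch_inf_Y_inv_eq
    by (simp add: ratio_series_def subst_y_mult subst_y_inv_mult 1 2 qpoch_inf_Y_eq qpoch_inf_Y_inv_eq)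
qed

text \<open>Each of the four Euler series obeys \<open>euler_series_eq\<close>. The denominators are
  multiplied out and the shifted ones cancelled, which is possible because their constant term is 1
  and the ring is a domain.\<close>

lemma ratio_series_q_shift:
  fixes x y :: "'a::idom"
  defines "L \<equiv> (\<lambda>c. 1 - fps_const (fps_const c) * fps_X)"
  shows "L x * L y * ratio_series x y = L (x * y) * L 1 * q_shift (ratio_series x y)"
proof -
  let ?a = "ratio_series x y" and ?s = "\<lambda>c. q_shift (euler_series c)"
  have E: "euler_series c = L c * ?s c" for c
    unfolding L_def by (rule euler_series_eq)
  have a: "?a * euler_series x * euler_series y = euler_series (x * y) * euler_series 1"
  proof -
    have "?a * euler_series x * euler_series y = euler_series (x * y) * euler_series 1 *
        (euler_series x * euler_inverse x) * (euler_series y * euler_inverse y)"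
      by (simp only: ratio_series_def mult_ac)
    then show ?thesis by (simp add: euler_inverse)
  qed
  have "L x * L y * ?a * (?s x * ?s y) = ?a * (L x * ?s x) * (L y * ?s y)"
    by (simp only: mult_ac)
  also have "\<dots> = (L (x * y) * ?s (x * y)) * (L 1 * ?s 1)"
    using a by (simp only: E [symmetric])
  also have "\<dots> = L (x * y) * L 1 * q_shift (euler_series (x * y) * euler_series 1)"
    by (simp only: q_shift_mult mult_ac)
  also have "\<dots> = L (x * y) * L 1 * q_shift ?a * (?s x * ?s y)"
    unfolding a [symmetric] by (simp only: q_shift_mult mult_ac)
  finally have "L x * L y * ?a * (?s x * ?s y) = L (x * y) * L 1 * q_shift ?a * (?s x * ?s y)" .
  moreover have "?s c \<noteq> 0" for c
  proof -
    have "?s c $ 0 = 1" by (simp add: q_shift_def)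
    then show ?thesis by (metis fps_zero_nth zero_neq_one)
  qed
  ultimately show ?thesis by (metis mult_right_cancel no_zero_divisors)
qed

text \<open>The sum is (x^n - y^n) / (x - y), written out because x - y need not be
  invertible.\<close>

definition ratio_weight :: "'a::comm_ring_1 \<Rightarrow> 'a \<Rightarrow> nat \<Rightarrow> 'a" where
  "ratio_weight x y n = - ((1 - x) * (1 - y) * (\<Sum>i<n. x ^ i * y ^ (n - 1 - i)))"

text \<open>With Y the formal variable, \<open>H\<close> is Y / ((1 - x Y) (1 - y Y)). Dividing the
  functional equation by the two linear factors turns it into F(Y) = (1 + k H) F(q Y), and
  coefficients are compared.\<close>

lemma ratio_series_rec:
  fixes x y :: "'a::idom"
  shows "ratio_series x y $ N = fps_X ^ N * ratio_series x y $ N +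
    (\<Sum>n=1..N. fps_const (ratio_weight x y n) * (fps_X ^ (N - n) * ratio_series x y $ (N - n)))"
proof -
  define L where "L = (\<lambda>c::'a. 1 - fps_const (fps_const c) * fps_X)"
  define h where "h = (\<lambda>n. \<Sum>i<n. x ^ i * y ^ (n - 1 - i))"
  define H where "H = Abs_fps (\<lambda>n. fps_const (h n))"
  define P where "P = Abs_fps (\<lambda>n. fps_const (y ^ n))"
  define k where "k = fps_const (fps_const (- ((1 - x) * (1 - y))))"
  let ?a = "ratio_series x y"
  have h_Suc: "h (Suc n) = x * h n + y ^ n" for n
    unfolding h_def by (simp add: sum.lessThan_Suc_shift sum_distrib_left mult.assoc del: sum.lessThan_Suc)
  have P: "L y * P = 1"
  proof (rule fps_ext)
    fix n show "(L y * P) $ n = 1 $ n"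
      by (cases n) (simp_all add: L_def P_def left_diff_distrib mult.assoc)
  qed
  have LH: "L x * H = fps_X * P"
  proof (rule fps_ext)
    fix n show "(L x * H) $ n = (fps_X * P) $ n"
    proof (cases n)
      case 0
      then show ?thesis by (simp add: L_def H_def P_def left_diff_distrib mult.assoc h_def)
    next
      case (Suc m)
      then show ?thesis
        by (simp add: L_def H_def P_def left_diff_distrib mult.assoc h_Suc flip: fps_const_add)
    qed
  qed
  have "L x * L y * H = L y * (L x * H)"
    by (simp only: mult_ac)
  also have "\<dots> = fps_X * (L y * P)"
    unfolding LH by (simp only: mult_ac)
  finally have H: "L x * L y * H = fps_X"
    by (simp only: P mult_1_right)
  \<comment> \<open>The two quadratics in Y agree except in the linear term, where the difference is
    - (1 - x) (1 - y).\<close>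
  have "L (x * y) * L 1 = L x * L y + k * fps_X"
  proof -
    define C where "C = (\<lambda>c::'a. fps_const (fps_const c))"
    have Cc: "fps_const (fps_const c) = C c" for c by (simp add: C_def)
    have hom: "C (a * b) = C a * C b" "C (a - b) = C a - C b" "C (- a) = - C a" "C 1 = 1" for a b
      by (simp_all add: C_def)
    have C: "C (x * y) = C x * C y" "C 1 = 1" "k = - ((1 - C x) * (1 - C y))"
      unfolding k_def Cc by (simp_all only: hom)
    show ?thesis
      unfolding L_def Cc C by (simp add: algebra_simps)
  qed
  also have "\<dots> = L x * L y * (1 + k * H)"
    using H by (simp only: distrib_left mult_1_right mult.left_commute)
  finally have "L x * L y * ?a = L x * L y * ((1 + k * H) * q_shift ?a)"
    using ratio_series_q_shift[of x y] by (simp add: L_def mult.assoc)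
  moreover have "L c \<noteq> 0" for c
  proof -
    have "L c $ 0 = 1" by (simp add: L_def)
    then show ?thesis by (metis fps_zero_nth zero_neq_one)
  qed
  ultimately have "?a = (1 + k * H) * q_shift ?a" by simp
  then have "?a $ N = (q_shift ?a + (k * H) * q_shift ?a) $ N"
    by (simp add: distrib_right)
  also have "\<dots> = fps_X ^ N * ?a $ N + (\<Sum>n=0..N. (k * H) $ n * (fps_X ^ (N - n) * ?a $ (N - n)))"
    by (simp add: q_shift_def fps_mult_nth[of "k * H"])
  also have "(\<Sum>n=0..N. (k * H) $ n * (fps_X ^ (N - n) * ?a $ (N - n))) =
      (\<Sum>n=0..N. fps_const (ratio_weight x y n) * (fps_X ^ (N - n) * ?a $ (N - n)))"
    by (simp add: k_def H_def ratio_weight_def h_def)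
  also have "\<dots> =
      (\<Sum>n=1..N. fps_const (ratio_weight x y n) * (fps_X ^ (N - n) * ?a $ (N - n)))"
    by (subst sum.atLeast_Suc_atMost) (simp_all add: ratio_weight_def)
  finally show ?thesis .
qed

section \<open>Sums over compositions\<close>

text \<open>Unfolded, this is the sum over compositions of N of the product of the \<alpha> values
  of the parts, with a factor q^T / (1 - q^T) at every partial sum T.\<close>

function chain_seq :: "(nat \<Rightarrow> 'a::comm_ring_1) \<Rightarrow> nat \<Rightarrow> 'a fps" where
  "chain_seq \<alpha> N = (if N = 0 then 1
     else lambert 0 N * (\<Sum>n=1..N. fps_const (\<alpha> n) * chain_seq \<alpha> (N - n)))"
  by pat_completeness auto
termination by (relation "Wellfounded.measure snd") auto

declare chain_seq.simps [simp del]

lemma chain_seq_0 [simp]: "chain_seq \<alpha> 0 = 1"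
  by (simp add: chain_seq.simps)

lemma chain_seq_eq:
  "N > 0 \<Longrightarrow> chain_seq \<alpha> N = lambert 0 N * (\<Sum>n=1..N. fps_const (\<alpha> n) * chain_seq \<alpha> (N - n))"
  by (subst chain_seq.simps) simp

text \<open>Both forms come from one induction: the first at smaller indices turns the recurrence
  into the second, and multiplying by q^N gives the first back.\<close>

lemma ratio_series_nth:
  fixes x y :: "'a::idom"
  shows "fps_X ^ N * ratio_series x y $ N = chain_seq (ratio_weight x y) N"
    and "N > 0 \<Longrightarrow> ratio_series x y $ N = (1 + lambert 0 N) *
      (\<Sum>n=1..N. fps_const (ratio_weight x y n) * chain_seq (ratio_weight x y) (N - n))"
proof (induction N rule: less_induct)
  case (less N)
  let ?a = "ratio_series x y $ N"
  let ?s = "\<Sum>n=1..N. fps_const (ratio_weight x y n) * chain_seq (ratio_weight x y) (N - n)"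
  have a: "?a = (1 + lambert 0 N) * ?s" if "N > 0"
  proof -
    have "?a = fps_X ^ N * ?a + (\<Sum>n=1..N. fps_const (ratio_weight x y n) *
        (fps_X ^ (N - n) * ratio_series x y $ (N - n)))"
      by (rule ratio_series_rec)
    also have "(\<Sum>n=1..N. fps_const (ratio_weight x y n) *
        (fps_X ^ (N - n) * ratio_series x y $ (N - n))) = ?s"
      using that by (intro sum.cong) (auto simp: less.IH(1))
    finally have "(1 - fps_X ^ N) * ?a = ?s" by (simp add: algebra_simps)
    then have "(1 + lambert 0 N) * ((1 - fps_X ^ N) * ?a) = (1 + lambert 0 N) * ?s"
      by simp
    then have "((1 - fps_X ^ N) * (1 + lambert 0 N)) * ?a = (1 + lambert 0 N) * ?s"
      by (simp only: mult_ac)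
    then show ?thesis using that by (simp add: one_plus_lambert_0_inverse)
  qed
  {
    case 2
    then show ?case by (rule a)
  next
    case 1
    show ?case
    proof (cases "N = 0")
      case True
      then show ?thesis
        by (simp add: ratio_series_def euler_inverse_def)
    next
      case False
      then have N: "N > 0" by simp
      have "fps_X ^ N * (1 + lambert 0 N) = lambert 0 N * (1 - fps_X ^ N) * (1 + lambert 0 N :: 'a fps)"
        by (simp only: lambert_0_eq[OF N])
      also have "\<dots> = lambert 0 N"
        using one_plus_lambert_0_inverse[OF N, where 'a='a] by (simp only: mult.assoc mult_1_right)
      finally have "fps_X ^ N * (1 + lambert 0 N) = (lambert 0 N :: 'a fps)" .
      with False show ?thesis
        by (simp add: a chain_seq_eq mult.assoc [symmetric])
    qed
  }
qed

definition pair_seq :: "(nat \<Rightarrow> 'a::comm_ring_1) \<Rightarrow> (nat \<Rightarrow> 'a) \<Rightarrow> nat \<Rightarrow> 'a fps" where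
  "pair_seq \<alpha> \<beta> N = lambert 1 N * ((\<Sum>n=1..N. fps_const (\<alpha> n) * chain_seq \<alpha> (N - n)) *
     (\<Sum>n=1..N. fps_const (\<beta> n) * chain_seq \<beta> (N - n)))"

text \<open>N = 0 contributes 1. For N > 0, q^N and the two factors 1 / (1 - q^N) combine to q^N /
  (1 - q^N)^2, which is \<open>lambert 1 N\<close>.\<close>

lemma gen_series_nth_0:
  "gen_series $ k $$ 0 = (if k = 0 then 1 else 0) +
    (\<Sum>N\<le>k. pair_seq (ratio_weight exp_z1 exp_z2) (ratio_weight exp_v1 exp_v2) N $ k)"
proof -
  let ?a = "ratio_series exp_z1 exp_z2" and ?b = "ratio_series exp_v1 exp_v2"
  let ?p = "pair_seq (ratio_weight exp_z1 exp_z2) (ratio_weight exp_v1 exp_v2)"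
  have [simp]: "?a $ 0 = 1" "?b $ 0 = 1"
    by (simp_all add: ratio_series_def euler_inverse_def)
  have *: "fps_X ^ N * ?a $ N * ?b $ N = (if N = 0 then 1 else 0) + ?p N" for N
  proof (cases "N = 0")
    case False
    let ?l = "lambert 0 N :: rat fps4 fps"
    have "fps_X ^ N * (1 + ?l) * (1 + ?l) = lambert 1 N * (1 - fps_X ^ N) * (1 - fps_X ^ N) * (1 + ?l) * (1 + ?l)"
      using False by (simp only: lambert_1_eq lambert_0_eq neq0_conv)
    also have "\<dots> = lambert 1 N * ((1 - fps_X ^ N) * (1 + ?l)) * ((1 - fps_X ^ N) * (1 + ?l))"
      by (simp only: mult_ac)
    also have "\<dots> = lambert 1 N"
      using False by (simp add: one_plus_lambert_0_inverse)
    finally have "fps_X ^ N * (1 + ?l) * (1 + ?l) = lambert 1 N" .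
    with False show ?thesis
      by (simp add: ratio_series_nth(2) pair_seq_def mult_ac)
  qed (simp add: pair_seq_def)
  have "(\<Sum>N\<le>k. (if N = 0 then 1 else 0 :: rat fps4 fps) $ k) = 1 $ k"
    by (simp add: fps_sum_nth [symmetric] sum.delta del: fps_one_nth)
  then show ?thesis
    unfolding gen_series_eq subst_y_mult_subst_y_inv_nth * by (simp add: sum.distrib)
qed

section \<open>Weights of pairs of compositions\<close>

definition vanishes_below :: "nat \<Rightarrow> rat fps4 \<Rightarrow> bool" where
  "vanishes_below d f \<longleftrightarrow> (\<forall>m n m' n'. m + n + m' + n' < d \<longrightarrow> f $ m $ n $ m' $ n' = 0)"

definition coef4 :: "nat \<Rightarrow> nat \<Rightarrow> nat \<Rightarrow> nat \<Rightarrow> rat fps4 fps \<Rightarrow> rat fps" where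
  "coef4 m n m' n' s = Abs_fps (\<lambda>k. s $ k $ m $ n $ m' $ n')"

lemma fps4_mult_nth:
  fixes f g :: "'a::comm_ring_1 fps4"
  shows "(f * g) $ m $ n $ m' $ n' = (\<Sum>a\<le>m. \<Sum>b\<le>n. \<Sum>a'\<le>m'. \<Sum>b'\<le>n'.
     f $ a $ b $ a' $ b' * g $ (m - a) $ (n - b) $ (m' - a') $ (n' - b'))"
  by (simp add: fps_mult_nth fps_sum_nth atLeast0AtMost)

lemma vanishes_below_mult:
  assumes "vanishes_below d f" "vanishes_below e g"
  shows "vanishes_below (d + e) (f * g)"
  unfolding vanishes_below_def fps4_mult_nth
proof (intro allI impI sum.neutral ballI)
  fix m n m' n' a b a' b'
  assume *: "m + n + m' + n' < d + e" "a \<in> {..m}" "b \<in> {..n}" "a' \<in> {..m'}" "b' \<in> {..n'}"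
  show "f $ a $ b $ a' $ b' * g $ (m - a) $ (n - b) $ (m' - a') $ (n' - b') = 0"
  proof (cases "a + b + a' + b' < d")
    case False
    with * have "(m - a) + (n - b) + (m' - a') + (n' - b') < e" by auto
    with assms(2) show ?thesis by (simp add: vanishes_below_def)
  qed (use assms(1) in \<open>simp add: vanishes_below_def\<close>)
qed

lemma vanishes_below_uminus: "vanishes_below d f \<Longrightarrow> vanishes_below d (- f)"
  by (simp add: vanishes_below_def)

lemma coef4_nth [simp]: "coef4 m n m' n' s $ k = s $ k $ m $ n $ m' $ n'"
  by (simp add: coef4_def)

lemma coef4_add: "coef4 m n m' n' (s + t) = coef4 m n m' n' s + coef4 m n m' n' t"
  by (rule fps_ext) simp

lemma coef4_sum: "coef4 m n m' n' (\<Sum>x\<in>A. f x) = (\<Sum>x\<in>A. coef4 m n m' n' (f x))"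
  by (rule fps_ext) (simp add: fps_sum_nth)

lemma coef4_mult:
  "coef4 m n m' n' (s * t) = (\<Sum>a\<le>m. \<Sum>b\<le>n. \<Sum>a'\<le>m'. \<Sum>b'\<le>n'.
     coef4 a b a' b' s * coef4 (m - a) (n - b) (m' - a') (n' - b') t)"
proof (rule fps_ext)
  fix k
  have "coef4 m n m' n' (s * t) $ k = (\<Sum>i=0..k. \<Sum>a\<le>m. \<Sum>b\<le>n. \<Sum>a'\<le>m'. \<Sum>b'\<le>n'.
      s $ i $ a $ b $ a' $ b' * t $ (k - i) $ (m - a) $ (n - b) $ (m' - a') $ (n' - b'))"
    by (simp only: coef4_nth fps_mult_nth[of s] fps_sum_nth fps4_mult_nth)
  also have "\<dots> = (\<Sum>a\<le>m. \<Sum>b\<le>n. \<Sum>a'\<le>m'. \<Sum>b'\<le>n'. \<Sum>i=0..k.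
      s $ i $ a $ b $ a' $ b' * t $ (k - i) $ (m - a) $ (n - b) $ (m' - a') $ (n' - b'))"
    by (simp only: sum.swap[of _ _ "{0..k}"])
  also have "\<dots> = (\<Sum>a\<le>m. \<Sum>b\<le>n. \<Sum>a'\<le>m'. \<Sum>b'\<le>n'.
      coef4 a b a' b' s * coef4 (m - a) (n - b) (m' - a') (n' - b') t) $ k"
    by (simp only: fps_sum_nth) (simp add: fps_mult_nth)
  finally show "coef4 m n m' n' (s * t) $ k = \<dots>" .
qed

lemma coef4_const: "coef4 m n m' n' (fps_const c) = fps_const (c $ m $ n $ m' $ n')"
  by (rule fps_ext) simp

lemma coef4_of_nat_mult: "coef4 m n m' n' (of_nat a * s) = of_nat a * coef4 m n m' n' s"
  by (rule fps_ext) (simp add: fps_mult_of_nat_nth)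

lemma coef4_of_nat_power_mult:
  "coef4 m n m' n' (of_nat a ^ p * s) = of_nat a ^ p * coef4 m n m' n' s"
  using coef4_of_nat_mult[of m n m' n' "a ^ p" s] by simp

lemma coef4_of_nat_power:
  "coef4 m n m' n' (of_nat a ^ p) = (if m + n + m' + n' = 0 then of_nat a ^ p else 0)"
proof -
  have "coef4 m n m' n' 1 = (if m + n + m' + n' = 0 then 1 else 0)"
    by (rule fps_ext) auto
  then show ?thesis using coef4_of_nat_power_mult[of m n m' n' a p 1] by simp
qed

lemma coef4_lambert_mult: "coef4 m n m' n' (lambert e N * s) = lambert e N * coef4 m n m' n' s"
proof (rule fps_ext)
  fix k
  show "coef4 m n m' n' (lambert e N * s) $ k = (lambert e N * coef4 m n m' n' s) $ k"
  proof (cases "N = 0")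
    case False
    then show ?thesis
      by (simp add: lambert_mult_nth fps_sum_nth fps_mult_of_nat_nth flip: of_nat_power)
  qed simp
qed

section \<open>Filtrations by weight\<close>

text \<open>An increasing filtration by rational subspaces, abstracted so as to treat
  \<open>open_seq\<close> and \<open>closed_seq\<close> together.\<close>

definition graded_space :: "(int \<Rightarrow> (nat \<Rightarrow> rat fps) \<Rightarrow> bool) \<Rightarrow> bool" where
  "graded_space V \<longleftrightarrow> (\<forall>k. V k (\<lambda>_. 0)) \<and>
     (\<forall>k F G. V k F \<longrightarrow> V k G \<longrightarrow> V k (\<lambda>N. F N + G N)) \<and>
     (\<forall>k c F. V k F \<longrightarrow> V k (\<lambda>N. fps_const c * F N)) \<and>
     (\<forall>k k' F. V k F \<longrightarrow> k \<le> k' \<longrightarrow> V k' F)"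

lemma graded_space_closed_seq: "graded_space closed_seq"
  unfolding graded_space_def
  by (intro conjI allI impI closed_seq.zero closed_seq.add closed_seq.scale)
    (assumption | erule (1) closed_seq_mono)+

lemma graded_space_open_seq: "graded_space open_seq"
  unfolding graded_space_def
  by (intro conjI allI impI open_seq_zero open_seq_add open_seq_scale)
    (assumption | erule (1) open_seq_mono)+

lemma graded_space_sum:
  assumes "graded_space V" "\<And>i. i \<in> A \<Longrightarrow> V k (F i)"
  shows "V k (\<lambda>N. \<Sum>i\<in>A. F i N)"
  using assms(2)
  by (induction A rule: infinite_finite_induct) (use assms(1) in \<open>auto simp: graded_space_def\<close>)

text \<open>The weight may grow with the total degree, with offset w. The cut-off D confines the
  claim to low degrees, so that it can be proved by induction on D.\<close>

definition weight_bounded ::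
    "(int \<Rightarrow> (nat \<Rightarrow> rat fps) \<Rightarrow> bool) \<Rightarrow> nat \<Rightarrow> int \<Rightarrow> (nat \<Rightarrow> rat fps4 fps) \<Rightarrow> bool" where
  "weight_bounded V D w F \<longleftrightarrow> (\<forall>m n m' n'. m + n + m' + n' < D \<longrightarrow>
     V (w + int (m + n + m' + n')) (\<lambda>N. coef4 m n m' n' (F N)))"

lemma weight_bounded_add:
  "graded_space V \<Longrightarrow> weight_bounded V D w F \<Longrightarrow> weight_bounded V D w G \<Longrightarrow>
   weight_bounded V D w (\<lambda>N. F N + G N)"
  by (simp add: weight_bounded_def coef4_add graded_space_def)

lemma weight_bounded_sum:
  "graded_space V \<Longrightarrow> (\<And>i. i \<in> A \<Longrightarrow> weight_bounded V D w (F i)) \<Longrightarrow>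
   weight_bounded V D w (\<lambda>N. \<Sum>i\<in>A. F i N)"
  unfolding weight_bounded_def coef4_sum
  by (intro allI impI, rule graded_space_sum[where V = V]) auto

lemma weight_bounded_mono:
  assumes "graded_space V" "weight_bounded V D w F" "D' \<le> D" "w \<le> w'"
  shows "weight_bounded V D' w' F"
  unfolding weight_bounded_def
proof (intro allI impI)
  fix m n m' n' :: nat
  assume "m + n + m' + n' < D'"
  then have "V (w + int (m + n + m' + n')) (\<lambda>N. coef4 m n m' n' (F N))"
    using assms(2,3) by (simp add: weight_bounded_def)
  moreover have "w + int (m + n + m' + n') \<le> w' + int (m + n + m' + n')"
    using assms(4) by simp
  ultimately show "V (w' + int (m + n + m' + n')) (\<lambda>N. coef4 m n m' n' (F N))"
    using assms(1) unfolding graded_space_def by blast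
qed

text \<open>A factor of order d uses up at least d of the total degree, so what is left for F has
  degree smaller by d. Both the gain in the cut-off and the gain in the weight come from
  this.\<close>

lemma weight_bounded_scale:
  assumes V: "graded_space V" and F: "weight_bounded V D w F" and c: "vanishes_below d c"
  shows "weight_bounded V (D + d) (w - int d) (\<lambda>N. fps_const c * F N)"
  unfolding weight_bounded_def
proof (intro allI impI)
  fix m n m' n' :: nat
  assume *: "m + n + m' + n' < D + d"
  show "V (w - int d + int (m + n + m' + n')) (\<lambda>N. coef4 m n m' n' (fps_const c * F N))"
    unfolding coef4_mult coef4_const
  proof (intro graded_space_sum[OF V])
    fix a b a' b' assume ab: "a \<in> {..m}" "b \<in> {..n}" "a' \<in> {..m'}" "b' \<in> {..n'}"
    show "V (w - int d + int (m + n + m' + n'))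
        (\<lambda>N. fps_const (c $ a $ b $ a' $ b') * coef4 (m - a) (n - b) (m' - a') (n' - b') (F N))"
    proof (cases "a + b + a' + b' < d")
      case True
      then have "c $ a $ b $ a' $ b' = 0" using c by (simp add: vanishes_below_def)
      then show ?thesis using V by (simp add: graded_space_def)
    next
      case False
      let ?r = "(m - a) + (n - b) + (m' - a') + (n' - b')"
      have "?r < D" using * ab False by auto
      then have "V (w + int ?r) (\<lambda>N. coef4 (m - a) (n - b) (m' - a') (n' - b') (F N))"
        using F by (simp add: weight_bounded_def)
      moreover have "w + int ?r \<le> w - int d + int (m + n + m' + n')"
        using ab False by (auto simp: of_nat_diff)
      ultimately show ?thesis using V unfolding graded_space_def by blast
    qed
  qed
qed

lemma weight_bounded_of_nat_mult:
  assumes "graded_space V" "weight_bounded V D w F"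
  shows "weight_bounded V D w (\<lambda>N. of_nat a * F N)"
  using weight_bounded_scale[OF assms, of 0 "of_nat a"]
  by (simp add: vanishes_below_def fps_of_nat)

lemma weight_bounded_lambert:
  assumes "weight_bounded open_seq D w F"
  shows "weight_bounded closed_seq D (w + int e) (\<lambda>N. lambert e N * F N)"
  using assms by (auto simp: weight_bounded_def coef4_lambert_mult open_seq_def add_ac)

lemma weight_bounded_conv:
  assumes "weight_bounded closed_seq D w F"
  shows "weight_bounded open_seq D (w + int p + 1) (\<lambda>N. \<Sum>u=1..N. of_nat u ^ p * F (N - u))"
  unfolding weight_bounded_def coef4_sum coef4_of_nat_power_mult
proof (intro allI impI)
  fix m n m' n' :: nat
  assume "m + n + m' + n' < D"
  then have "closed_seq (w + int (m + n + m' + n')) (\<lambda>N. coef4 m n m' n' (F N))"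
    using assms by (simp add: weight_bounded_def)
  from open_seq_conv[OF this, of p]
  show "open_seq (w + int p + 1 + int (m + n + m' + n'))
      (\<lambda>N. \<Sum>u = 1..N. of_nat u ^ p * coef4 m n m' n' (F (N - u)))"
    by (simp add: add_ac)
qed

lemma weight_bounded_power:
  assumes "p > 0"
  shows "weight_bounded open_seq D (int p + 1) (\<lambda>N. of_nat N ^ p)"
  unfolding weight_bounded_def coef4_of_nat_power
proof (intro allI impI)
  fix m n m' n' :: nat
  show "open_seq (int p + 1 + int (m + n + m' + n'))
      (\<lambda>N. if m + n + m' + n' = 0 then of_nat N ^ p else 0)"
    using assms by (cases "m + n + m' + n' = 0") (simp_all only: if_False open_seq_zero, simp add: open_seq_power)
qed

section \<open>Products of two sums over compositions\<close>

definition block_sum :: "nat \<Rightarrow> (nat \<Rightarrow> 'a::comm_ring_1) \<Rightarrow> nat \<Rightarrow> 'a" where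
  "block_sum i E N = (\<Sum>n=1..N. of_nat n ^ i * E (N - n))"

lemma block_sum_0 [simp]: "block_sum i E 0 = 0"
  by (simp add: block_sum_def)

text \<open>The square is split into the diagonal and the two triangles, with w the minimum of the
  two indices and t their difference.\<close>

lemma sum_square_split:
  fixes f :: "nat \<Rightarrow> nat \<Rightarrow> 'a::comm_monoid_add"
  shows "(\<Sum>n=1..N. \<Sum>m=1..N. f n m) =
    (\<Sum>w=1..N. f w w + (\<Sum>t=1..N - w. f (w + t) w) + (\<Sum>t=1..N - w. f w (w + t)))"
proof (induction N)
  case (Suc N)
  have "(\<Sum>w=1..N. f w w + (\<Sum>t=1..Suc N - w. f (w + t) w) + (\<Sum>t=1..Suc N - w. f w (w + t))) =
      (\<Sum>w=1..N. (f w w + (\<Sum>t=1..N - w. f (w + t) w) + (\<Sum>t=1..N - w. f w (w + t))) +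
        (f (Suc N) w + f w (Suc N)))"
    by (rule sum.cong) (auto simp: Suc_diff_le add_ac)
  also have "\<dots> = (\<Sum>n=1..N. \<Sum>m=1..N. f n m) + ((\<Sum>w=1..N. f (Suc N) w) + (\<Sum>w=1..N. f w (Suc N)))"
    by (simp only: sum.distrib[symmetric] Suc.IH)
  finally show ?case
    by (simp add: sum.distrib add_ac)
qed simp

lemma block_sum_mult_shift:
  fixes E :: "nat \<Rightarrow> 'a::comm_ring_1"
  shows "(\<Sum>t=1..M. of_nat (w + t) ^ i * E (M - t)) =
    (\<Sum>i'\<le>i. of_nat (i choose i') * (of_nat w ^ (i - i') * block_sum i' E M))"
proof -
  have "(\<Sum>t=1..M. of_nat (w + t) ^ i * E (M - t)) =
      (\<Sum>t=1..M. \<Sum>i'\<le>i. of_nat (i choose i') * (of_nat w ^ (i - i') * (of_nat t ^ i' * E (M - t))))"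
    unfolding of_nat_add add.commute[of "of_nat w"] binomial_ring sum_distrib_right
    by (intro sum.cong refl) (simp only: mult_ac)
  also have "\<dots> = (\<Sum>i'\<le>i. of_nat (i choose i') * (of_nat w ^ (i - i') * block_sum i' E M))"
    by (subst sum.swap) (simp add: block_sum_def sum_distrib_left)
  finally show ?thesis .
qed

text \<open>If one last part is longer than the other, the shorter one w is a part of the common
  refinement and the rest t of the longer stays in a block sum at N - w; (w + t)^i is expanded
  binomially.\<close>

lemma block_sum_mult:
  fixes E E' :: "nat \<Rightarrow> 'a::comm_ring_1"
  shows "block_sum i E N * block_sum j E' N =
    (\<Sum>w=1..N. of_nat w ^ (i + j) * (E (N - w) * E' (N - w))) +
    (\<Sum>i'\<le>i. of_nat (i choose i') *
       (\<Sum>w=1..N. of_nat w ^ (j + (i - i')) * (block_sum i' E (N - w) * E' (N - w)))) +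
    (\<Sum>j'\<le>j. of_nat (j choose j') *
       (\<Sum>w=1..N. of_nat w ^ (i + (j - j')) * (E (N - w) * block_sum j' E' (N - w))))"
proof -
  have "block_sum i E N * block_sum j E' N =
      (\<Sum>n=1..N. \<Sum>m=1..N. of_nat n ^ i * of_nat m ^ j * (E (N - n) * E' (N - m)))"
    by (simp add: block_sum_def sum_product mult_ac)
  also have "\<dots> = (\<Sum>w=1..N. of_nat w ^ (i + j) * (E (N - w) * E' (N - w)) +
      of_nat w ^ j * E' (N - w) * (\<Sum>t=1..N - w. of_nat (w + t) ^ i * E (N - w - t)) +
      of_nat w ^ i * E (N - w) * (\<Sum>t=1..N - w. of_nat (w + t) ^ j * E' (N - w - t)))"
    unfolding sum_square_split
    by (simp add: sum_distrib_left power_add mult_ac)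
  also have "\<dots> = (\<Sum>w=1..N. of_nat w ^ (i + j) * (E (N - w) * E' (N - w))) +
      (\<Sum>w=1..N. \<Sum>i'\<le>i. of_nat (i choose i') *
        (of_nat w ^ (j + (i - i')) * (block_sum i' E (N - w) * E' (N - w)))) +
      (\<Sum>w=1..N. \<Sum>j'\<le>j. of_nat (j choose j') *
        (of_nat w ^ (i + (j - j')) * (E (N - w) * block_sum j' E' (N - w))))"
    unfolding block_sum_mult_shift sum.distrib sum_distrib_left power_add
    by (simp only: mult_ac)
  finally show ?thesis
    unfolding sum_distrib_left by (simp only: sum.swap[of _ _ "{1..N}"])
qed

text \<open>Starting at j = 1 excludes a constant term; this is the source of the positive exponent
  of the first part.\<close>

definition poly_weight :: "(nat \<Rightarrow> 'a::comm_ring_1) \<Rightarrow> nat \<Rightarrow> nat \<Rightarrow> 'a" where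
  "poly_weight A J n = (\<Sum>j=1..J. of_nat n ^ j * A j)"

lemma fps_const_sum: "fps_const (\<Sum>x\<in>A. f x) = (\<Sum>x\<in>A. fps_const (f x))"
  by (rule fps_ext) (simp add: fps_sum_nth)

lemma sum_poly_weight:
  fixes A :: "nat \<Rightarrow> 'a::comm_ring_1" and E :: "nat \<Rightarrow> 'a fps"
  shows "(\<Sum>n=1..N. fps_const (poly_weight A J n) * E (N - n)) =
    (\<Sum>j=1..J. fps_const (A j) * block_sum j E N)"
proof -
  have "fps_const (poly_weight A J n) = (\<Sum>j=1..J. of_nat n ^ j * fps_const (A j))" for n
    by (simp add: poly_weight_def fps_const_sum fps_of_nat [symmetric] fps_const_power)
  then have "(\<Sum>n=1..N. fps_const (poly_weight A J n) * E (N - n)) =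
      (\<Sum>n=1..N. \<Sum>j=1..J. fps_const (A j) * (of_nat n ^ j * E (N - n)))"
    by (simp only: sum_distrib_right) (simp only: mult_ac)
  also have "\<dots> = (\<Sum>j=1..J. fps_const (A j) * block_sum j E N)"
    by (subst sum.swap) (simp add: block_sum_def sum_distrib_left)
  finally show ?thesis .
qed

lemma chain_seq_poly_weight:
  "chain_seq (poly_weight A J) N = (if N = 0 then 1 else 0) +
    lambert 0 N * (\<Sum>j=1..J. fps_const (A j) * block_sum j (chain_seq (poly_weight A J)) N)"
proof (cases "N = 0")
  case False
  then show ?thesis
    using chain_seq_eq[of N "poly_weight A J"] sum_poly_weight[of A J "chain_seq (poly_weight A J)" N]
    by simp
qed simp

text \<open>
  Splitting off the last part \<open>w\<close> of the common refinement (\<open>n = m\<close>, \<open>m < n\<close> or \<open>n < m\<close>) expresses the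
  product through products of the same kind with a coefficient \<open>A a\<close> or \<open>B b\<close>, of positive order,
  in front.  Hence the induction on the total degree \<open>D\<close>.
\<close>

lemma weight_bounded_block_sums:
  fixes A B :: "nat \<Rightarrow> rat fps4" and J
  defines "E \<equiv> chain_seq (poly_weight A J)" and "E' \<equiv> chain_seq (poly_weight B J)"
  assumes A: "\<And>j. j \<in> {1..J} \<Longrightarrow> vanishes_below (j + 1) (A j)"
    and B: "\<And>j. j \<in> {1..J} \<Longrightarrow> vanishes_below (j + 1) (B j)"
    and "i + j > 0"
  shows "weight_bounded open_seq D (int (i + j) + 1) (\<lambda>N. block_sum i E N * block_sum j E' N)"
  using \<open>i + j > 0\<close>
proof (induction D arbitrary: i j)
  case 0
  show ?case by (simp add: weight_bounded_def)
next
  case (Suc D)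
  define G where "G = (\<lambda>i j N. block_sum i E N * block_sum j E' N)"
  define G0 where "G0 = (\<lambda>N. (lambert 1 N - lambert 0 N) *
    (\<Sum>a=1..J. \<Sum>b=1..J. fps_const (A a * B b) * G a b N))"
  define G1 where "G1 = (\<lambda>a N. lambert 0 N * (\<Sum>b=1..J. fps_const (B b) * G a b N))"
  define G2 where "G2 = (\<lambda>b N. lambert 0 N * (\<Sum>a=1..J. fps_const (A a) * G a b N))"
  have IH: "weight_bounded open_seq D (int (i + j) + 1) (G i j)" if "i + j > 0" for i j
    using Suc.IH[OF that] by (simp add: G_def)
  \<comment> \<open>For N > 0 both chains carry q^N / (1 - q^N); the square is rewritten by
    \<open>lambert_0_square\<close>.\<close>
  have EE': "E N * E' N = (if N = 0 then 1 else 0) + G0 N" for N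
  proof (cases "N = 0")
    case False
    then have "E N * E' N = (lambert 0 N * lambert 0 N) *
        ((\<Sum>a=1..J. fps_const (A a) * block_sum a E N) * (\<Sum>b=1..J. fps_const (B b) * block_sum b E' N))"
      using chain_seq_poly_weight[of A J N] chain_seq_poly_weight[of B J N]
      by (simp add: E_def E'_def mult_ac)
    then show ?thesis
      using False unfolding lambert_0_square
      by (simp add: G0_def G_def sum_product mult_ac fps_const_mult [symmetric] del: fps_const_mult)
  qed (simp add: E_def E'_def G0_def)
  have XE': "block_sum a E N * E' N = G1 a N" for a N
    using chain_seq_poly_weight[of B J N]
    by (cases "N = 0") (simp_all add: E'_def G1_def G_def sum_distrib_left mult_ac)
  have EX': "E N * block_sum b E' N = G2 b N" for b N
    using chain_seq_poly_weight[of A J N]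
    by (cases "N = 0") (simp_all add: E_def G2_def G_def sum_distrib_left mult_ac)
  note graded = graded_space_open_seq graded_space_closed_seq
  \<comment> \<open>\<open>G a b\<close> has weight a + b + 1. The factor \<open>B b\<close> of
    order b + 1 lowers it to a and lifts the cut-off from D to at least Suc D. Since b \<ge> 1, the
    induction hypothesis applies even when a = 0.\<close>
  have G1: "weight_bounded closed_seq (Suc D) (int a) (G1 a)" for a
  proof -
    have "weight_bounded open_seq (Suc D) (int a) (\<lambda>N. \<Sum>b=1..J. fps_const (B b) * G a b N)"
    proof (rule weight_bounded_sum[OF graded(1)])
      fix b assume b: "b \<in> {1..J}"
      show "weight_bounded open_seq (Suc D) (int a) (\<lambda>N. fps_const (B b) * G a b N)"
        by (rule weight_bounded_mono[OF graded(1) weight_bounded_scale[OF graded(1) IH B[OF b]]])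
          (use b in auto)
    qed
    from weight_bounded_lambert[OF this, of 0] show ?thesis by (simp add: G1_def)
  qed
  have G2: "weight_bounded closed_seq (Suc D) (int b) (G2 b)" for b
  proof -
    have "weight_bounded open_seq (Suc D) (int b) (\<lambda>N. \<Sum>a=1..J. fps_const (A a) * G a b N)"
    proof (rule weight_bounded_sum[OF graded(1)])
      fix a assume a: "a \<in> {1..J}"
      show "weight_bounded open_seq (Suc D) (int b) (\<lambda>N. fps_const (A a) * G a b N)"
        by (rule weight_bounded_mono[OF graded(1) weight_bounded_scale[OF graded(1) IH A[OF a]]])
          (use a in auto)
    qed
    from weight_bounded_lambert[OF this, of 0] show ?thesis by (simp add: G2_def)
  qed
  have G0: "weight_bounded closed_seq (Suc D) 0 G0"
  proof -
    define S where "S = (\<lambda>N. \<Sum>a=1..J. \<Sum>b=1..J. fps_const (A a * B b) * G a b N)"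
    \<comment> \<open>The weight is a + b + 1 - (a + 1) - (b + 1) = -1; the factor
      \<open>lambert 1 N\<close> then raises it to 0.\<close>
    have *: "weight_bounded open_seq (Suc D) (- 1) S"
      unfolding S_def
    proof (intro weight_bounded_sum[OF graded(1)])
      fix a b assume ab: "a \<in> {1..J}" "b \<in> {1..J}"
      show "weight_bounded open_seq (Suc D) (- 1) (\<lambda>N. fps_const (A a * B b) * G a b N)"
        by (rule weight_bounded_mono[OF graded(1) weight_bounded_scale[OF graded(1) IH
              vanishes_below_mult[OF A[OF ab(1)] B[OF ab(2)]]]]) (use ab in auto)
    qed
    have "weight_bounded closed_seq (Suc D) 0 (\<lambda>N. lambert 0 N * S N)"
      by (rule weight_bounded_mono[OF graded(2) weight_bounded_lambert[OF *, of 0]]) auto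
    then have neg: "weight_bounded closed_seq (Suc D) 0
        (\<lambda>N. fps_const (- 1) * (lambert 0 N * S N))"
      using weight_bounded_scale[OF graded(2), of "Suc D" 0 _ 0 "- 1"] by (simp add: vanishes_below_def)
    have "weight_bounded closed_seq (Suc D) 0 (\<lambda>N. lambert 1 N * S N)"
      using weight_bounded_lambert[OF *, of 1] by simp
    from weight_bounded_add[OF graded(2) this neg] show ?thesis
      by (simp add: G0_def S_def left_diff_distrib flip: fps_const_neg)
  qed
  \<comment> \<open>The summand 1 of E E' at 0: both compositions end with the shared part w =
    N.\<close>
  have delta: "(\<Sum>w=1..N. of_nat w ^ (i + j) * (if N - w = 0 then 1 else 0)) = (of_nat N ^ (i + j) :: rat fps4 fps)" for N
  proof (cases N)
    case (Suc N')
    have "(\<Sum>w=1..N. of_nat w ^ (i + j) * (if N - w = 0 then 1 else 0)) =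
        (\<Sum>w=1..N. if w = N then of_nat N ^ (i + j) else (0 :: rat fps4 fps))"
      by (rule sum.cong) auto
    then show ?thesis using Suc by simp
  qed (use Suc.prems in simp)
  have "(\<lambda>N. block_sum i E N * block_sum j E' N) = (\<lambda>N. of_nat N ^ (i + j) +
      (\<Sum>w=1..N. of_nat w ^ (i + j) * G0 (N - w)) +
      (\<Sum>a\<le>i. of_nat (i choose a) * (\<Sum>w=1..N. of_nat w ^ (j + (i - a)) * G1 a (N - w))) +
      (\<Sum>b\<le>j. of_nat (j choose b) * (\<Sum>w=1..N. of_nat w ^ (i + (j - b)) * G2 b (N - w))))"
    unfolding block_sum_mult EE' XE' EX' distrib_left sum.distrib delta ..
  \<comment> \<open>Convolving weight a with the power j + (i - a) adds j + (i - a) + 1, so the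
    total is always i + j + 1.\<close>
  moreover have "weight_bounded open_seq (Suc D) (int (i + j) + 1) \<dots>"
  proof (intro weight_bounded_add[OF graded(1)] weight_bounded_sum[OF graded(1)]
      weight_bounded_of_nat_mult[OF graded(1)])
    show "weight_bounded open_seq (Suc D) (int (i + j) + 1) (\<lambda>N. of_nat N ^ (i + j))"
      by (rule weight_bounded_power[OF Suc.prems])
    show "weight_bounded open_seq (Suc D) (int (i + j) + 1)
        (\<lambda>N. \<Sum>w=1..N. of_nat w ^ (i + j) * G0 (N - w))"
      using weight_bounded_conv[OF G0, of "i + j"] by simp
    show "weight_bounded open_seq (Suc D) (int (i + j) + 1)
        (\<lambda>N. \<Sum>w=1..N. of_nat w ^ (j + (i - a)) * G1 a (N - w))" if "a \<in> {..i}" for a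
      using weight_bounded_conv[OF G1[of a], of "j + (i - a)"] that by (simp add: of_nat_diff add_ac)
    show "weight_bounded open_seq (Suc D) (int (i + j) + 1)
        (\<lambda>N. \<Sum>w=1..N. of_nat w ^ (i + (j - b)) * G2 b (N - w))" if "b \<in> {..j}" for b
      using weight_bounded_conv[OF G2[of b], of "i + (j - b)"] that by (simp add: of_nat_diff add_ac)
  qed
  ultimately show ?case by simp
qed

lemma weight_bounded_pair_seq:
  assumes A: "\<And>j. j \<in> {1..J} \<Longrightarrow> vanishes_below (j + 1) (A j)"
    and B: "\<And>j. j \<in> {1..J} \<Longrightarrow> vanishes_below (j + 1) (B j)"
  shows "weight_bounded closed_seq D 0 (pair_seq (poly_weight A J) (poly_weight B J))"
proof -
  let ?E = "chain_seq (poly_weight A J)" and ?E' = "chain_seq (poly_weight B J)"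
  have "weight_bounded open_seq D (- 1)
      (\<lambda>N. \<Sum>a=1..J. \<Sum>b=1..J. fps_const (A a * B b) * (block_sum a ?E N * block_sum b ?E' N))"
  proof (intro weight_bounded_sum[OF graded_space_open_seq])
    fix a b assume ab: "a \<in> {1..J}" "b \<in> {1..J}"
    have "weight_bounded open_seq D (int (a + b) + 1) (\<lambda>N. block_sum a ?E N * block_sum b ?E' N)"
      by (rule weight_bounded_block_sums[OF A B]) (use ab in auto)
    from weight_bounded_scale[OF graded_space_open_seq this
        vanishes_below_mult[OF A[OF ab(1)] B[OF ab(2)]]]
    show "weight_bounded open_seq D (- 1)
        (\<lambda>N. fps_const (A a * B b) * (block_sum a ?E N * block_sum b ?E' N))"
      by (rule weight_bounded_mono[OF graded_space_open_seq]) auto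
  qed
  moreover have "pair_seq (poly_weight A J) (poly_weight B J) = (\<lambda>N. lambert 1 N *
      (\<Sum>a=1..J. \<Sum>b=1..J. fps_const (A a * B b) * (block_sum a ?E N * block_sum b ?E' N)))"
    by (rule ext)
      (simp only: pair_seq_def sum_poly_weight sum_product fps_const_mult [symmetric] mult_ac)
  ultimately show ?thesis
    using weight_bounded_lambert[of D "- 1" _ 1] by simp
qed

section \<open>Truncation in the total degree\<close>

definition agree_below :: "nat \<Rightarrow> rat fps4 fps \<Rightarrow> rat fps4 fps \<Rightarrow> bool" where
  "agree_below d s t \<longleftrightarrow> (\<forall>m n m' n'. m + n + m' + n' < d \<longrightarrow> coef4 m n m' n' s = coef4 m n m' n' t)"

lemma agree_below_refl: "agree_below d s s"
  by (simp add: agree_below_def)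

lemma agree_below_sum:
  "(\<And>x. x \<in> A \<Longrightarrow> agree_below d (f x) (g x)) \<Longrightarrow> agree_below d (\<Sum>x\<in>A. f x) (\<Sum>x\<in>A. g x)"
  by (auto simp: agree_below_def coef4_sum intro!: sum.cong)

lemma agree_below_mult:
  assumes "agree_below d s t" "agree_below d s' t'"
  shows "agree_below d (s * s') (t * t')"
  unfolding agree_below_def coef4_mult
proof (intro allI impI sum.cong refl)
  fix m n m' n' a b a' b'
  assume *: "m + n + m' + n' < d" "a \<in> {..m}" "b \<in> {..n}" "a' \<in> {..m'}" "b' \<in> {..n'}"
  have "a + b + a' + b' < d" "(m - a) + (n - b) + (m' - a') + (n' - b') < d"
    using * by auto
  then show "coef4 a b a' b' s * coef4 (m - a) (n - b) (m' - a') (n' - b') s' =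
      coef4 a b a' b' t * coef4 (m - a) (n - b) (m' - a') (n' - b') t'"
    using assms by (simp add: agree_below_def)
qed

lemma agree_below_const:
  "vanishes_below d (c - c') \<Longrightarrow> agree_below d (fps_const c) (fps_const c')"
  by (simp add: agree_below_def vanishes_below_def coef4_const)

text \<open>This permits replacing the weights by polynomials in n that match them only up to a
  given total degree.\<close>

lemma agree_below_chain_seq:
  assumes "\<And>n. vanishes_below d (\<alpha> n - \<beta> n)"
  shows "agree_below d (chain_seq \<alpha> N) (chain_seq \<beta> N)"
proof (induction N rule: less_induct)
  case (less N)
  show ?case
  proof (cases "N = 0")
    case False
    then have N: "N > 0" by simp
    show ?thesis
      unfolding chain_seq_eq[OF N]
      by (intro agree_below_mult agree_below_sum agree_below_const agree_below_refl less assms)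
        (use N in auto)
  qed (simp add: agree_below_refl)
qed

lemma agree_below_pair_seq:
  assumes "\<And>n. vanishes_below d (\<alpha> n - \<alpha>' n)" "\<And>n. vanishes_below d (\<beta> n - \<beta>' n)"
  shows "agree_below d (pair_seq \<alpha> \<beta> N) (pair_seq \<alpha>' \<beta>' N)"
  unfolding pair_seq_def
  by (intro agree_below_mult agree_below_sum agree_below_const agree_below_refl
      agree_below_chain_seq assms)

section \<open>Power sums as polynomials without constant term\<close>

definition poly_fun :: "nat \<Rightarrow> (nat \<Rightarrow> rat) \<Rightarrow> bool" where
  "poly_fun d f \<longleftrightarrow> (\<exists>p. degree p \<le> d \<and> poly p 0 = 0 \<and> (\<forall>n. f n = poly p (of_nat n)))"

lemma poly_fun_add: "poly_fun d f \<Longrightarrow> poly_fun d g \<Longrightarrow> poly_fun d (\<lambda>n. f n + g n)"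
  unfolding poly_fun_def by (metis add.right_neutral degree_add_le poly_add)

lemma poly_fun_cmult: "poly_fun d f \<Longrightarrow> poly_fun d (\<lambda>n. c * f n)"
  unfolding poly_fun_def by (metis degree_smult_le le_trans mult_zero_right poly_smult)

lemma poly_fun_sum: "(\<And>i. i \<in> A \<Longrightarrow> poly_fun d (f i)) \<Longrightarrow> poly_fun d (\<lambda>n. \<Sum>i\<in>A. f i n)"
proof (induction A rule: infinite_finite_induct)
  case (insert x A)
  then show ?case by (simp add: poly_fun_add)
qed (auto simp: poly_fun_def intro!: exI[of _ 0])

lemma poly_fun_mono: "poly_fun d f \<Longrightarrow> d \<le> d' \<Longrightarrow> poly_fun d' f"
  unfolding poly_fun_def by (meson le_trans)

lemma poly_fun_times_n: 
  assumes "poly_fun d f"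
  shows "poly_fun (Suc d) (\<lambda>n. of_nat n * f n)"
proof -
  obtain p where p: "degree p \<le> d" "poly p 0 = 0" "\<And>n. f n = poly p (of_nat n)"
    using assms by (auto simp: poly_fun_def)
  have "degree (pCons 0 p) \<le> Suc d"
    using degree_pCons_le[of 0 p] p(1) by linarith
  then show ?thesis
    unfolding poly_fun_def by (intro exI[of _ "pCons 0 p"]) (simp add: p)
qed

lemma poly_fun_power: "d > 0 \<Longrightarrow> poly_fun d (\<lambda>n. of_nat n ^ d)"
  unfolding poly_fun_def
  by (intro exI[of _ "monom 1 d"]) (simp add: poly_monom degree_monom_le)

text \<open>Telescoping (i + 1)^(r + 1) - i^(r + 1) writes n^(r + 1) through the power sums of
  exponent at most r; the one of exponent r has coefficient r + 1 and is solved for.\<close>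

lemma poly_fun_sum_powers: "poly_fun (Suc r) (\<lambda>n. \<Sum>i<n. of_nat i ^ r)"
proof (induction r rule: less_induct)
  case (less r)
  have tele: "of_nat n ^ Suc r = (\<Sum>i<n. \<Sum>k\<le>r. of_nat (Suc r choose k) * of_nat i ^ k :: rat)" for n
  proof (induction n)
    case (Suc n)
    have "(of_nat (Suc n) :: rat) ^ Suc r = (of_nat n + 1) ^ Suc r"
      by (simp add: add.commute)
    also have "\<dots> = (\<Sum>k\<le>Suc r. of_nat (Suc r choose k) * of_nat n ^ k)"
      by (subst binomial_ring) simp
    also have "\<dots> = (\<Sum>k\<le>r. of_nat (Suc r choose k) * of_nat n ^ k) + of_nat n ^ Suc r"
      by (subst sum.atMost_Suc) (simp del: binomial_Suc_Suc power_Suc)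
    finally show ?case unfolding Suc.IH by simp
  qed simp
  have "(\<Sum>i<n. of_nat i ^ r) = 1 / of_nat (Suc r) * (of_nat n ^ Suc r +
      (\<Sum>k<r. - of_nat (Suc r choose k) * (\<Sum>i<n. of_nat i ^ k :: rat)))" for n
  proof -
    have "of_nat n ^ Suc r = (\<Sum>k\<le>r. of_nat (Suc r choose k) * (\<Sum>i<n. of_nat i ^ k :: rat))"
      unfolding tele sum_distrib_left by (rule sum.swap)
    also have "\<dots> = (\<Sum>k<r. of_nat (Suc r choose k) * (\<Sum>i<n. of_nat i ^ k)) +
        of_nat (Suc r) * (\<Sum>i<n. of_nat i ^ r)"
      by (simp add: lessThan_Suc_atMost [symmetric] del: binomial_Suc_Suc)
    finally show ?thesis
      by (simp add: sum_negf field_simps del: binomial_Suc_Suc power_Suc)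
  qed
  moreover have "poly_fun (Suc r) (\<lambda>n. 1 / of_nat (Suc r) * (of_nat n ^ Suc r +
      (\<Sum>k<r. - of_nat (Suc r choose k) * (\<Sum>i<n. of_nat i ^ k))))"
    by (intro poly_fun_cmult poly_fun_add poly_fun_sum poly_fun_power poly_fun_mono[OF less]) auto
  ultimately show ?case by presburger
qed

text \<open>One factor n - 1 - i is split into its three terms. The term in i raises r, so the
  induction on s keeps r arbitrary.\<close>

lemma poly_fun_sum_powers_conv:
  "poly_fun (r + s + 1) (\<lambda>n. \<Sum>i<n. of_nat i ^ r * of_nat (n - 1 - i) ^ s)"
proof (induction s arbitrary: r)
  case 0
  show ?case using poly_fun_sum_powers[of r] by simp
next
  case (Suc s)
  define f where "f = (\<lambda>r n. \<Sum>i<n. of_nat i ^ r * of_nat (n - 1 - i) ^ s :: rat)"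
  have IH: "poly_fun (r + s + 1) (f r)" for r
    using Suc.IH by (simp add: f_def)
  have eq: "(\<Sum>i<n. of_nat i ^ r * of_nat (n - 1 - i) ^ Suc s) =
      of_nat n * f r n + (- 1) * f r n + (- 1) * f (Suc r) n" for n
  proof -
    have "(\<Sum>i<n. of_nat i ^ r * of_nat (n - 1 - i) ^ Suc s) =
        (\<Sum>i<n. of_nat n * (of_nat i ^ r * of_nat (n - 1 - i) ^ s) +
          (- 1) * (of_nat i ^ r * of_nat (n - 1 - i) ^ s) +
          (- 1) * (of_nat i ^ Suc r * of_nat (n - 1 - i) ^ s :: rat))"
    proof (rule sum.cong)
      fix i assume "i \<in> {..<n}"
      then have "of_nat (n - 1 - i) = (of_nat n - 1 - of_nat i :: rat)"
        by (simp add: of_nat_diff)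
      then show "of_nat i ^ r * of_nat (n - 1 - i) ^ Suc s =
          of_nat n * (of_nat i ^ r * of_nat (n - 1 - i) ^ s) +
          (- 1) * (of_nat i ^ r * of_nat (n - 1 - i) ^ s) +
          (- 1) * (of_nat i ^ Suc r * of_nat (n - 1 - i) ^ s :: rat)"
        by (simp add: algebra_simps)
    qed simp
    then show ?thesis by (simp add: f_def sum.distrib sum_distrib_left sum_subtractf sum_negf)
  qed
  have "poly_fun (r + Suc s + 1) (\<lambda>n. of_nat n * f r n + (- 1) * f r n + (- 1) * f (Suc r) n)"
    by (intro poly_fun_add poly_fun_cmult poly_fun_mono[OF poly_fun_times_n[OF IH]]
        poly_fun_mono[OF IH]) auto
  then show ?case unfolding eq .
qed

lemma poly_fun_coeffs:
  assumes "poly_fun d f"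
  obtains c where "\<And>j. j > d \<Longrightarrow> c j = 0" "\<And>n J. d \<le> J \<Longrightarrow> f n = (\<Sum>j=1..J. of_nat n ^ j * c j)"
proof -
  obtain p where p: "degree p \<le> d" "poly p 0 = 0" "\<And>n. f n = poly p (of_nat n)"
    using assms by (auto simp: poly_fun_def)
  show thesis
  proof
    show "coeff p j = 0" if "j > d" for j
      using p(1) that by (intro coeff_eq_0) simp
    show "f n = (\<Sum>j=1..J. of_nat n ^ j * coeff p j)" if "d \<le> J" for n J
    proof -
      have "f n = (\<Sum>j\<le>degree p. of_nat n ^ j * coeff p j)"
        by (simp add: p(3) poly_altdef mult.commute)
      also have "\<dots> = (\<Sum>j\<in>{0..J}. of_nat n ^ j * coeff p j)"
        using p(1) that by (intro sum.mono_neutral_left) (auto simp: coeff_eq_0)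
      also have "\<dots> = (\<Sum>j=1..J. of_nat n ^ j * coeff p j)"
        using p(2) by (subst sum.atLeast_Suc_atMost) (simp_all add: poly_0_coeff_0)
      finally show ?thesis .
    qed
  qed
qed

lemma fps4_of_nat_power_mult_nth:
  "(of_nat a ^ p * f :: rat fps4) $ m $ n $ m' $ n' = of_nat a ^ p * f $ m $ n $ m' $ n'"
  by (simp add: fps_mult_of_nat_nth flip: of_nat_power)

text \<open>A coefficient of x^i y^(n - 1 - i) is a constant times i^r (n - 1 - i)^s, whose sum over
  i is a polynomial in n of degree at most r + s + 1. So n^j needs total degree at least j - 1, and
  (1 - x) (1 - y) adds 2.\<close>

lemma ratio_weight_approx:
  fixes x y :: "rat fps4"
  assumes xy: "\<And>a b m n m' n'. (x ^ a * y ^ b) $ m $ n $ m' $ n' =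
      K m n m' n' * of_nat a ^ r m n m' n' * of_nat b ^ s m n m' n'"
    and rs: "\<And>m n m' n'. r m n m' n' + s m n m' n' \<le> m + n + m' + n'"
  obtains A where "\<And>j. j > 0 \<Longrightarrow> vanishes_below (j + 1) (A j)"
    "\<And>n. vanishes_below J (ratio_weight x y n - poly_weight A J n)"
proof -
  define P where "P = (\<lambda>r s (c :: nat \<Rightarrow> rat). (\<forall>j>r+s+1. c j = 0) \<and> (\<forall>n J. r + s + 1 \<le> J \<longrightarrow>
      (\<Sum>i<n. of_nat i ^ r * of_nat (n - 1 - i) ^ s) = (\<Sum>j=1..J. of_nat n ^ j * c j)))"
  have "\<exists>c. P r s c" for r s
    unfolding P_def by (rule poly_fun_coeffs[OF poly_fun_sum_powers_conv[of r s]]) blast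
  \<comment> \<open>One coefficient function per pair (r, s), independent of n and J.\<close>
  then obtain c where P: "\<And>r s. P r s (c r s)" by metis
  have c0: "c r s j = 0" if "j > r + s + 1" for r s j
    using P[of r s] that unfolding P_def by blast
  have c: "(\<Sum>i<n. of_nat i ^ r * of_nat (n - 1 - i) ^ s) = (\<Sum>j=1..J. of_nat n ^ j * c r s j)"
    if "r + s + 1 \<le> J" for r s n J
    using P[of r s] that unfolding P_def by blast
  define h where "h = (\<lambda>n. \<Sum>i<n. x ^ i * y ^ (n - 1 - i))"
  define H where "H = (\<lambda>j. Abs_fps (\<lambda>m. Abs_fps (\<lambda>n. Abs_fps (\<lambda>m'. Abs_fps (\<lambda>n'.
    K m n m' n' * c (r m n m' n') (s m n m' n') j)))))"
  define k where "k = - ((1 - x) * (1 - y))"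
  have K0: "K 0 0 0 0 = 1" "r 0 0 0 0 = 0" "s 0 0 0 0 = 0"
    using xy[of 0 0 0 0 0 0] rs[of 0 0 0 0] by simp_all
  \<comment> \<open>Both x and y have constant term 1, read off from \<open>xy\<close> at total
    degree 0.\<close>
  have "vanishes_below 1 (1 - x)" "vanishes_below 1 (1 - y)"
    using xy[of 1 0 0 0 0 0] xy[of 0 1 0 0 0 0] by (auto simp: vanishes_below_def K0)
  from vanishes_below_uminus[OF vanishes_below_mult[OF this]]
  have k: "vanishes_below 2 k" by (simp add: k_def numeral_2_eq_2)
  have H: "vanishes_below (j - 1) (H j)" for j
    unfolding vanishes_below_def
  proof (intro allI impI)
    fix m n m' n' assume "m + n + m' + n' < j - 1"
    then have "j > r m n m' n' + s m n m' n' + 1" using rs[of m n m' n'] by linarith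
    then show "H j $ m $ n $ m' $ n' = 0" by (simp add: H_def c0)
  qed
  have hH: "vanishes_below J (h n - (\<Sum>j=1..J. of_nat n ^ j * H j))" for n
    unfolding vanishes_below_def
  proof (intro allI impI)
    fix m n1 m' n' assume "m + n1 + m' + n' < J"
    then have *: "r m n1 m' n' + s m n1 m' n' + 1 \<le> J" using rs[of m n1 m' n'] by linarith
    have "h n $ m $ n1 $ m' $ n' = K m n1 m' n' *
        (\<Sum>i<n. of_nat i ^ r m n1 m' n' * of_nat (n - 1 - i) ^ s m n1 m' n')"
      by (simp add: h_def fps_sum_nth xy sum_distrib_left mult.assoc)
    also have "\<dots> = (\<Sum>j=1..J. of_nat n ^ j * H j) $ m $ n1 $ m' $ n'"
      unfolding c[OF *]
      by (simp add: H_def fps_sum_nth fps4_of_nat_power_mult_nth sum_distrib_left mult_ac)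
    finally show "(h n - (\<Sum>j=1..J. of_nat n ^ j * H j)) $ m $ n1 $ m' $ n' = 0" by simp
  qed
  show thesis
  proof
    show "vanishes_below (j + 1) (k * H j)" if "j > 0" for j
      using vanishes_below_mult[OF k H[of j]] that by simp
    show "vanishes_below J (ratio_weight x y n - poly_weight (\<lambda>j. k * H j) J n)" for n
    proof -
      have "ratio_weight x y n - poly_weight (\<lambda>j. k * H j) J n =
          k * (h n - (\<Sum>j=1..J. of_nat n ^ j * H j))"
      proof -
        have "ratio_weight x y n = k * h n"
          by (simp only: ratio_weight_def k_def h_def mult_minus_left)
        moreover have "poly_weight (\<lambda>j. k * H j) J n = k * (\<Sum>j=1..J. of_nat n ^ j * H j)"
          by (simp only: poly_weight_def sum_distrib_left mult.left_commute)
        ultimately show ?thesis by (simp only: right_diff_distrib)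
      qed
      moreover have "vanishes_below J (k * (h n - (\<Sum>j=1..J. of_nat n ^ j * H j)))"
        using vanishes_below_mult[OF k hH] by (simp add: vanishes_below_def)
      ultimately show ?thesis by simp
    qed
  qed
qed

text \<open>A ring homomorphism applied coefficientwise commutes with powers; it serves to move
  powers through the nested constant embeddings.\<close>

lemma Abs_fps_map_power:
  fixes h :: "'a::comm_ring_1 \<Rightarrow> 'b::comm_ring_1"
  assumes "h 0 = 0" "h 1 = 1" "\<And>x y. h (x + y) = h x + h y" "\<And>x y. h (x * y) = h x * h y"
  shows "Abs_fps (\<lambda>n. h (f $ n)) ^ a = Abs_fps (\<lambda>n. h ((f ^ a) $ n))"
proof (induction a)
  case 0
  show ?case by (rule fps_ext) (simp add: assms)
next
  case (Suc a)
  have h_sum: "h (sum g S) = (\<Sum>x\<in>S. h (g x))" for g :: "nat \<Rightarrow> 'a" and S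
    by (induction S rule: infinite_finite_induct) (simp_all add: assms)
  show ?case
    by (rule fps_ext) (simp add: Suc.IH fps_mult_nth h_sum assms)
qed

text \<open>The product is exp(a z1 + b z2), with coefficients in the shape that
  \<open>ratio_weight_approx\<close> expects.\<close>

lemma exp_z_nth:
  "(exp_z1 ^ a * exp_z2 ^ b) $ m $ n $ m' $ n' =
    (if m' = 0 \<and> n' = 0 then 1 / (fact m * fact n) else 0) * of_nat a ^ m * of_nat b ^ n"
proof -
  have "exp_z1 ^ a = Abs_fps (\<lambda>n. fps_const (fps_const (fps_const (fps_exp (of_nat a) $ n))))"
    unfolding exp_z1_def by (subst Abs_fps_map_power) (simp_all add: fps_exp_power_mult)
  moreover have "exp_z2 ^ b = fps_const (Abs_fps (\<lambda>n. fps_const (fps_const (fps_exp (of_nat b) $ n))))"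
    unfolding exp_z2_def fps_const_power
    by (subst Abs_fps_map_power) (simp_all add: fps_exp_power_mult)
  ultimately show ?thesis by simp
qed

lemma exp_v_nth:
  "(exp_v1 ^ a * exp_v2 ^ b) $ m $ n $ m' $ n' =
    (if m = 0 \<and> n = 0 then 1 / (fact m' * fact n') else 0) * of_nat a ^ m' * of_nat b ^ n'"
proof -
  have "exp_v1 ^ a = fps_const (fps_const (Abs_fps (\<lambda>n. fps_const (fps_exp (of_nat a) $ n))))"
    unfolding exp_v1_def fps_const_power
    by (subst Abs_fps_map_power) (simp_all add: fps_exp_power_mult)
  moreover have "exp_v2 ^ b = fps_const (fps_const (fps_const (fps_exp (of_nat b))))"
    by (simp add: exp_v2_def fps_exp_power_mult)
  ultimately show ?thesis by simp
qed

lemma one_in_qBD_upto: "1 \<in> qBD_upto k"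
proof -
  have "bi_bracket_index 0 N = (if N = 0 then {([], [])} else {})" for N
    by (auto simp: bi_bracket_index_def)
  then have "bi_bracket [] [] = 1"
    by (intro fps_ext) (simp add: bi_bracket_def)
  then show ?thesis
    unfolding qBD_upto_def rat_span_def
    by (intro rat_fps.span_base CollectI exI[of _ "[]"]) (simp add: bi_admissible_def bi_weight_def)
qed

theorem theorem4p6:
  shows "coeff_y0 gen_series \<in> fps4_over qBD \<and>
    (\<forall>m n m' n'. coeff_y0 gen_series $ m $ n $ m' $ n' \<in> qBD_upto (m + n + m' + n'))"
proof -
  have *: "coeff_y0 gen_series $ m $ n $ m' $ n' \<in> qBD_upto (m + n + m' + n')" for m n m' n'
  proof -
    \<comment> \<open>The degree D itself must be covered, so every truncation below is at Suc
      D.\<close>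
    define D where "D = m + n + m' + n'"
    let ?\<alpha> = "ratio_weight exp_z1 exp_z2" and ?\<beta> = "ratio_weight exp_v1 exp_v2"
    obtain A where A: "\<And>j. j > 0 \<Longrightarrow> vanishes_below (j + 1) (A j)"
      "\<And>i. vanishes_below (Suc D) (?\<alpha> i - poly_weight A (Suc D) i)"
      by (rule ratio_weight_approx[OF exp_z_nth]) auto
    obtain B where B: "\<And>j. j > 0 \<Longrightarrow> vanishes_below (j + 1) (B j)"
      "\<And>i. vanishes_below (Suc D) (?\<beta> i - poly_weight B (Suc D) i)"
      by (rule ratio_weight_approx[OF exp_v_nth]) auto
    have "weight_bounded closed_seq (Suc D) 0
        (pair_seq (poly_weight A (Suc D)) (poly_weight B (Suc D)))"
      by (rule weight_bounded_pair_seq) (use A(1) B(1) in auto)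
    then have "closed_seq (int D)
        (\<lambda>N. coef4 m n m' n' (pair_seq (poly_weight A (Suc D)) (poly_weight B (Suc D)) N))"
      by (auto simp: weight_bounded_def D_def)
    moreover have "coef4 m n m' n' (pair_seq (poly_weight A (Suc D)) (poly_weight B (Suc D)) N) =
        coef4 m n m' n' (pair_seq ?\<alpha> ?\<beta> N)" for N
      using agree_below_pair_seq[OF A(2) B(2), where N = N] by (simp add: agree_below_def D_def)
    ultimately have "closed_seq (int D) (\<lambda>N. coef4 m n m' n' (pair_seq ?\<alpha> ?\<beta> N))"
      by simp
    from closed_seq_sum_in_qBD_upto[OF this]
    have S: "Abs_fps (\<lambda>k. \<Sum>N\<le>k. coef4 m n m' n' (pair_seq ?\<alpha> ?\<beta> N) $ k) \<in> qBD_upto D" .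
    \<comment> \<open>The summand 1 from N = 0 is visible only in total degree 0; it is the empty
      bi-bracket.\<close>
    have eq: "coeff_y0 gen_series $ m $ n $ m' $ n' = fps_const (if D = 0 then 1 else 0) * 1 +
        Abs_fps (\<lambda>k. \<Sum>N\<le>k. coef4 m n m' n' (pair_seq ?\<alpha> ?\<beta> N) $ k)"
      by (rule fps_ext) (auto simp: coeff_y0_def gen_series_nth_0 fps_sum_nth D_def)
    show ?thesis
      unfolding D_def [symmetric] eq
      using S one_in_qBD_upto[of D] unfolding qBD_upto_def rat_span_def
      by (intro rat_fps.span_add rat_fps.span_scale)
  qed
  moreover have "qBD_upto k \<subseteq> qBD" for k
    unfolding qBD_upto_def qBD_def rat_span_def by (rule rat_fps.span_mono) auto
  ultimately show ?thesis unfolding fps4_over_def by blast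
qed

end
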